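(* Let $S$ and $U$ be two matrix sets. If $[0]_n\in\mathsf{col}^S(N)$ for every integer $n>0$ and every matrix $N\in U$ with $n$ rows, then every finitely complete category that has $M$-closed relations for every $M\in S$ also has $N$-closed relations for every $N\in U$, i.e., $\mathsf{mclex}\,S\subseteq\mathsf{mclex}\,U$. The converse implication also holds when no matrix in $S$ is trivial.
   Context: Matrices. For integers $n,k>0$ and $m\geqslant 0$, $\mathsf{matr}(n,m,k)$ is the set of $n\times m$ matrices with entries in $\{0,\dots,k-1\}$ ($m=0$ is allowed; such matrices are called empty). A matrix set is a subset of $\bigcup_{n>0,m\geqslant 0,k>0}\mathsf{matr}(n,m,k)$. $[0]_n$ is the column with $n$ entries, all $0$. Interpretations. A row-wise interpretation of $M=[a_{ij}]\in\mathsf{matr}(n,m,k)$ of type $(S_1,\dots,S_n)$ (sets) is given by functions $f_i\colon\{0,\dots,k-1\}\to S_i$ ($1\leqslant i\leqslant n$); it is the $n\times m$ matrix $[f_i(a_{ij})]$, whose columns are called left columns, extended by the right column $(f_1(0),\dots,f_n(0))$. An interpretation of $M$ of type $S$ is a row-wise interpretation of type $(S,\dots,S)$ with $f_1=\dots=f_n$. Closedness in categories. An internal $n$-ary relation on an object $C$ of a category $\mathbb{C}$ is an object $R$ with jointly monic morphisms $r_1,\dots,r_n\colon R\to C$. An element $(g_1,\dots,g_n)$ of $\mathbb{C}(X,C)^n$ belongs to the relation (over $X$) if there is $u\colon X\to R$ with $r_iu=g_i$ for all $i$. For $M$ with $n$ rows, the relation is $M$-closed if for every object $X$ and every interpretation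 of $M$ of type $\mathbb{C}(X,C)$ all of whose left columns belong to the relation over $X$, the right column also belongs to the relation over $X$. A category has $M$-closed relations if every internal $n$-ary relation on any object in it is $M$-closed. $\mathsf{mclex}\,S$ is the collection of all finitely complete categories having $M$-closed relations for every $M\in S$. Sharpness. A relation $R\subseteq X^n$ on a set $X$ is strictly $M'$-closed, for $M'$ with $n$ rows, if for every row-wise interpretation of $M'$ of type $(X,\dots,X)$ with all left columns in $R$, the right column is in $R$. For $M\in\mathsf{matr}(n',m',k')$, $R\subseteq X^n$ is $M$-sharp if it is strictly $M'$-closed for every $M'\in\mathsf{matr}(n,m',k')$ each of whose rows is a row of $M$. The relation $\mathsf{col}^S(N)$. For $N\in\mathsf{matr}(n,m,k)$, $\mathsf{col}(N)\subseteq\{0,\dots,k-1\}^n$ is the set of columns of $N$, viewed as an $n$-ary relation on $\{0,\dots,k-1\}$, and $\mathsf{col}^S(N)$ is the intersection of all $n$-ary relations on $\{0,\dots,k-1\}$ that contain $\mathsf{col}(N)$ and are $M$-sharp for all $M\in S$. Trivial matrices. A matrix $M$ is trivial if every finitely complete category with $M$-closed relations is a preorder (any two parallel morphisms are equal). *)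

theory Defs
  imports "Jordan_Normal_Form.Matrix" "HOL-Library.FuncSet"
begin

section \<open>Matrices and their interpretations\<close>

text \<open>Indices run from 0, so a matrix with \<open>n\<close> rows has the rows \<open>0, \<dots>, n - 1\<close>.\<close>

definition matr :: "nat \<Rightarrow> nat \<Rightarrow> nat \<Rightarrow> nat mat set" where
  "matr n m k = {A \<in> carrier_mat n m. \<forall>i<n. \<forall>j<m. A $$ (i, j) < k}"

definition matrix_set :: "nat mat set \<Rightarrow> bool" where
  "matrix_set S \<longleftrightarrow> S \<subseteq> {M. \<exists>n m k. n > 0 \<and> k > 0 \<and> M \<in> matr n m k}"

text \<open>The sets \<open>matr n m k\<close> increase with \<open>k\<close>, so a matrix determines \<open>n\<close> and \<open>m\<close> but not
  \<open>k\<close>.  The notions below whose wording refers to \<open>k\<close> take it as a parameter, or quantify over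
  every \<open>k\<close> with \<open>M \<in> matr n m k\<close>; which \<open>k\<close> one takes does not matter, because the values of a
  function on numbers that are neither 0 nor entries of the matrix are irrelevant.\<close>

definition row_wise_interpretation ::
    "nat \<Rightarrow> nat \<Rightarrow> (nat \<Rightarrow> 'a set) \<Rightarrow> (nat \<Rightarrow> nat \<Rightarrow> 'a) \<Rightarrow> bool" where
  "row_wise_interpretation n k T f \<longleftrightarrow> (\<forall>i<n. f i \<in> {..<k} \<rightarrow> T i)"

definition left_column :: "nat mat \<Rightarrow> (nat \<Rightarrow> nat \<Rightarrow> 'a) \<Rightarrow> nat \<Rightarrow> 'a vec" where
  "left_column M f j = vec (dim_row M) (\<lambda>i. f i (M $$ (i, j)))"

definition right_column :: "nat mat \<Rightarrow> (nat \<Rightarrow> nat \<Rightarrow> 'a) \<Rightarrow> 'a vec" where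
  "right_column M f = vec (dim_row M) (\<lambda>i. f i 0)"


section \<open>Categories and finite completeness\<close>

record ('o, 'a) category =
  Obj :: "'o set"
  Arr :: "'a set"
  Dom :: "'a \<Rightarrow> 'o"
  Cod :: "'a \<Rightarrow> 'o"
  Id :: "'o \<Rightarrow> 'a"
  Comp :: "'a \<Rightarrow> 'a \<Rightarrow> 'a"  \<comment> \<open>\<open>Comp C g f\<close> is \<open>g\<close> after \<open>f\<close>\<close>

definition Hom :: "('o, 'a) category \<Rightarrow> 'o \<Rightarrow> 'o \<Rightarrow> 'a set" where
  "Hom C X Y = {f \<in> Arr C. Dom C f = X \<and> Cod C f = Y}"

definition is_category :: "('o, 'a) category \<Rightarrow> bool" where
  "is_category C \<longleftrightarrow>
     (\<forall>f\<in>Arr C. Dom C f \<in> Obj C \<and> Cod C f \<in> Obj C) \<and>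
     (\<forall>X\<in>Obj C. Id C X \<in> Hom C X X) \<and>
     (\<forall>X\<in>Obj C. \<forall>Y\<in>Obj C. \<forall>Z\<in>Obj C. \<forall>f\<in>Hom C X Y. \<forall>g\<in>Hom C Y Z.
        Comp C g f \<in> Hom C X Z) \<and>
     (\<forall>X\<in>Obj C. \<forall>Y\<in>Obj C. \<forall>f\<in>Hom C X Y. Comp C f (Id C X) = f \<and> Comp C (Id C Y) f = f) \<and>
     (\<forall>W\<in>Obj C. \<forall>X\<in>Obj C. \<forall>Y\<in>Obj C. \<forall>Z\<in>Obj C.
        \<forall>f\<in>Hom C W X. \<forall>g\<in>Hom C X Y. \<forall>h\<in>Hom C Y Z.
        Comp C h (Comp C g f) = Comp C (Comp C h g) f)"

definition is_functor ::
    "('i, 'b) category \<Rightarrow> ('o, 'a) category \<Rightarrow> ('i \<Rightarrow> 'o) \<Rightarrow> ('b \<Rightarrow> 'a) \<Rightarrow> bool" where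
  "is_functor J C F\<^sub>o F\<^sub>a \<longleftrightarrow>
     (\<forall>i\<in>Obj J. F\<^sub>o i \<in> Obj C) \<and>
     (\<forall>a\<in>Arr J. F\<^sub>a a \<in> Hom C (F\<^sub>o (Dom J a)) (F\<^sub>o (Cod J a))) \<and>
     (\<forall>i\<in>Obj J. F\<^sub>a (Id J i) = Id C (F\<^sub>o i)) \<and>
     (\<forall>a\<in>Arr J. \<forall>b\<in>Arr J. Cod J a = Dom J b \<longrightarrow>
        F\<^sub>a (Comp J b a) = Comp C (F\<^sub>a b) (F\<^sub>a a))"

definition is_cone ::
    "('i, 'b) category \<Rightarrow> ('o, 'a) category \<Rightarrow> ('i \<Rightarrow> 'o) \<Rightarrow> ('b \<Rightarrow> 'a) \<Rightarrow> 'o \<Rightarrow> ('i \<Rightarrow> 'a) \<Rightarrow> bool"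
  where
  "is_cone J C F\<^sub>o F\<^sub>a L p \<longleftrightarrow>
     L \<in> Obj C \<and>
     (\<forall>i\<in>Obj J. p i \<in> Hom C L (F\<^sub>o i)) \<and>
     (\<forall>a\<in>Arr J. Comp C (F\<^sub>a a) (p (Dom J a)) = p (Cod J a))"

definition is_limit ::
    "('i, 'b) category \<Rightarrow> ('o, 'a) category \<Rightarrow> ('i \<Rightarrow> 'o) \<Rightarrow> ('b \<Rightarrow> 'a) \<Rightarrow> 'o \<Rightarrow> ('i \<Rightarrow> 'a) \<Rightarrow> bool"
  where
  "is_limit J C F\<^sub>o F\<^sub>a L p \<longleftrightarrow>
     is_cone J C F\<^sub>o F\<^sub>a L p \<and>
     (\<forall>X q. is_cone J C F\<^sub>o F\<^sub>a X q \<longrightarrow>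
        (\<exists>!u. u \<in> Hom C X L \<and> (\<forall>i\<in>Obj J. Comp C (p i) u = q i)))"

text \<open>Every finite category is isomorphic to one whose objects and arrows are natural numbers,
  so it suffices to take those as the shapes of finite diagrams.\<close>

definition finitely_complete :: "('o, 'a) category \<Rightarrow> bool" where
  "finitely_complete C \<longleftrightarrow>
     is_category C \<and>
     (\<forall>(J :: (nat, nat) category) F\<^sub>o F\<^sub>a.
        is_category J \<and> finite (Obj J) \<and> finite (Arr J) \<and> is_functor J C F\<^sub>o F\<^sub>a \<longrightarrow>
        (\<exists>L p. is_limit J C F\<^sub>o F\<^sub>a L p))"

definition is_preorder :: "('o, 'a) category \<Rightarrow> bool" where
  "is_preorder C \<longleftrightarrow> (\<forall>X\<in>Obj C. \<forall>Y\<in>Obj C. \<forall>f\<in>Hom C X Y. \<forall>g\<in>Hom C X Y. f = g)"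


section \<open>Closed relations in categories\<close>

definition internal_relation ::
    "('o, 'a) category \<Rightarrow> nat \<Rightarrow> 'o \<Rightarrow> 'o \<Rightarrow> 'a vec \<Rightarrow> bool" where
  "internal_relation C n A R r \<longleftrightarrow>
     A \<in> Obj C \<and> R \<in> Obj C \<and> r \<in> carrier_vec n \<and> (\<forall>i<n. r $ i \<in> Hom C R A) \<and>
     (\<forall>X\<in>Obj C. \<forall>g\<in>Hom C X R. \<forall>h\<in>Hom C X R.
        (\<forall>i<n. Comp C (r $ i) g = Comp C (r $ i) h) \<longrightarrow> g = h)"

definition belongs :: "('o, 'a) category \<Rightarrow> 'o \<Rightarrow> 'a vec \<Rightarrow> 'o \<Rightarrow> 'a vec \<Rightarrow> bool" where
  "belongs C R r X g \<longleftrightarrow> (\<exists>u\<in>Hom C X R. \<forall>i<dim_vec r. Comp C (r $ i) u = g $ i)"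

text \<open>An interpretation is a row-wise interpretation with the same function in each row.\<close>

definition relation_closed ::
    "('o, 'a) category \<Rightarrow> nat \<Rightarrow> nat mat \<Rightarrow> 'o \<Rightarrow> 'o \<Rightarrow> 'a vec \<Rightarrow> bool" where
  "relation_closed C k M A R r \<longleftrightarrow>
     (\<forall>X\<in>Obj C. \<forall>f. row_wise_interpretation (dim_row M) k (\<lambda>_. Hom C X A) (\<lambda>_. f) \<longrightarrow>
        (\<forall>j<dim_col M. belongs C R r X (left_column M (\<lambda>_. f) j)) \<longrightarrow>
        belongs C R r X (right_column M (\<lambda>_. f)))"

definition has_closed_relations :: "('o, 'a) category \<Rightarrow> nat mat \<Rightarrow> bool" where
  "has_closed_relations C M \<longleftrightarrow>
     (\<forall>n m k. n > 0 \<and> k > 0 \<and> M \<in> matr n m k \<longrightarrow>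
        (\<forall>A R r. internal_relation C n A R r \<longrightarrow> relation_closed C k M A R r))"

text \<open>The result type decides which categories are collected: those with objects in \<open>'o\<close> and
  arrows in \<open>'a\<close>.\<close>

definition mclex :: "nat mat set \<Rightarrow> ('o, 'a) category set" where
  "mclex S = {C. finitely_complete C \<and> (\<forall>M\<in>S. has_closed_relations C M)}"

text \<open>Likewise \<open>ty\<close> decides over which categories the definition quantifies.  Where a type is
  universally quantified outside a hypothesis \<open>\<not> trivial_matrix ty M\<close>, the hypothesis says that
  some type carries a category witnessing that \<open>M\<close> is not trivial.\<close>

definition trivial_matrix :: "('o, 'a) category itself \<Rightarrow> nat mat \<Rightarrow> bool" where
  "trivial_matrix ty M \<longleftrightarrow>
     (\<forall>C :: ('o, 'a) category. finitely_complete C \<and> has_closed_relations C M \<longrightarrow> is_preorder C)"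


section \<open>Sharp relations on sets\<close>

definition tuples :: "nat \<Rightarrow> 'a set \<Rightarrow> 'a vec set" where
  "tuples n X = {v \<in> carrier_vec n. \<forall>i<n. v $ i \<in> X}"

definition strictly_closed :: "'a set \<Rightarrow> nat \<Rightarrow> nat mat \<Rightarrow> 'a vec set \<Rightarrow> bool" where
  "strictly_closed X k M R \<longleftrightarrow>
     (\<forall>f. row_wise_interpretation (dim_row M) k (\<lambda>_. X) f \<longrightarrow>
        (\<forall>j<dim_col M. left_column M f j \<in> R) \<longrightarrow> right_column M f \<in> R)"

definition sharp :: "nat \<Rightarrow> 'a set \<Rightarrow> nat mat \<Rightarrow> 'a vec set \<Rightarrow> bool" where
  "sharp n X M R \<longleftrightarrow>
     (\<forall>n' m' k'. n' > 0 \<and> k' > 0 \<and> M \<in> matr n' m' k' \<longrightarrow>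
        (\<forall>M'\<in>matr n m' k'. set (rows M') \<subseteq> set (rows M) \<longrightarrow> strictly_closed X k' M' R))"

definition col_closure :: "nat \<Rightarrow> nat \<Rightarrow> nat mat set \<Rightarrow> nat mat \<Rightarrow> nat vec set" where
  "col_closure n k S N =
     \<Inter>{R. R \<subseteq> tuples n {..<k} \<and> set (cols N) \<subseteq> R \<and> (\<forall>M\<in>S. sharp n {..<k} M R)}"

end

(* If M is closed in C, then pulling an n-ary relation on A back to a relation on the power A^n shows
   that relations in C are also closed under interpretations of matrices of rows of M that
   differ from row to row. Hence an interpretation f of N turns a relation in C containing the left
   columns into the M-sharp relation {v. f v belongs} on {0, ..., k - 1}, which contains the columns
   of N, thus 0.

   For the converse consider the dual of the category of finite sets with an n-ary relation
   that is M-sharp for all M in S. A jointly monic family r_i there is a jointly surjective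
   family r_i: A -> R of structure maps. Given maps u_j with u_j r_i = f(M_ij), put
   u(r_i(x)) = f(0)(x). Sharpness of the target makes u a structure map, and u is well defined
   if f(0) is determined by the values of f on a row, consistently for different
   rows. The latter holds for nontrivial M: apply the first part to the equality relation of
   an object in a category with M-closed relations that is not a preorder. In this
   category, N-closedness of the structure freely generated by one related tuple says that
   0 lies in col^S(N). *)

theory Submission
  imports Defs "HOL-Library.Countable_Set"
begin

section \<open>Sharp relations\<close>

text \<open>A matrix whose rows are rows of \<open>M\<close> amounts to a choice
  \<open>\<sigma>\<close> of a row of \<open>M\<close> for each coordinate. Expressing sharpness
  through \<open>\<sigma>\<close> keeps the auxiliary matrices out of all later arguments.\<close>

lemma sharpI:
  assumes "\<And>n' m k \<sigma> f. \<lbrakk>0 < n'; 0 < k; M \<in> matr n' m k; \<And>i. i < n \<Longrightarrow> \<sigma> i < n';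
      \<And>i a. i < n \<Longrightarrow> a < k \<Longrightarrow> f i a \<in> X;
      \<And>j. j < m \<Longrightarrow> vec n (\<lambda>i. f i (M $$ (\<sigma> i, j))) \<in> R\<rbrakk> \<Longrightarrow> vec n (\<lambda>i. f i 0) \<in> R"
  shows "sharp n X M R"
  unfolding sharp_def strictly_closed_def
proof (intro allI impI ballI)
  fix n' m k M' f
  assume M: "0 < n' \<and> 0 < k \<and> M \<in> matr n' m k" and M': "M' \<in> matr n m k"
    and rows: "set (rows M') \<subseteq> set (rows M)"
    and f: "row_wise_interpretation (dim_row M') k (\<lambda>_. X) f"
    and left: "\<forall>j<dim_col M'. left_column M' f j \<in> R"
  have dims: "dim_row M = n'" "dim_col M = m" "dim_row M' = n" "dim_col M' = m"
    using M M' by (auto simp: matr_def)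
  have "\<exists>l<n'. row M' i = row M l" if "i < n" for i
  proof -
    have "row M' i \<in> set (rows M')"
      using that dims by (auto simp: rows_def)
    then have "row M' i \<in> set (rows M)"
      using rows by blast
    then show ?thesis
      using dims by (auto simp: rows_def)
  qed
  then obtain \<sigma> where \<sigma>: "\<And>i. i < n \<Longrightarrow> \<sigma> i < n' \<and> row M' i = row M (\<sigma> i)"
    by metis
  have entry: "M' $$ (i, j) = M $$ (\<sigma> i, j)" if "i < n" "j < m" for i j
    using \<sigma>[OF that(1)] that dims by (metis index_row(1))
  have "vec n (\<lambda>i. f i (M $$ (\<sigma> i, j))) = left_column M' f j" if "j < m" for j
    using that by (auto simp: left_column_def dims entry)
  then have "vec n (\<lambda>i. f i 0) \<in> R"
    using M \<sigma> f left dims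
    by (intro assms[of n' k m \<sigma> f]) (auto simp: row_wise_interpretation_def)
  then show "right_column M' f \<in> R"
    by (simp add: right_column_def dims)
qed

lemma sharpD:
  assumes sharp: "sharp n X M R" and M: "M \<in> matr n' m k" "0 < n'" "0 < k"
    and \<sigma>: "\<And>i. i < n \<Longrightarrow> \<sigma> i < n'"
    and f: "\<And>i a. i < n \<Longrightarrow> a < k \<Longrightarrow> f i a \<in> X"
    and left: "\<And>j. j < m \<Longrightarrow> vec n (\<lambda>i. f i (M $$ (\<sigma> i, j))) \<in> R"
  shows "vec n (\<lambda>i. f i 0) \<in> R"
proof -
  define M' where "M' = mat n m (\<lambda>(i, j). M $$ (\<sigma> i, j))"
  have M': "M' \<in> matr n m k"
    using M \<sigma> by (auto simp: matr_def M'_def)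
  have "row M' i \<in> set (rows M)" if "i < n" for i
  proof -
    have "row M' i = row M (\<sigma> i)"
      using that M \<sigma>[OF that] by (intro eq_vecI) (auto simp: M'_def matr_def)
    then show ?thesis
      using M \<sigma>[OF that] by (auto simp: rows_def matr_def)
  qed
  then have "set (rows M') \<subseteq> set (rows M)"
    by (auto simp: rows_def M'_def)
  then have "strictly_closed X k M' R"
    using sharp M M' unfolding sharp_def by blast
  moreover have "row_wise_interpretation (dim_row M') k (\<lambda>_. X) f"
    using f by (auto simp: row_wise_interpretation_def M'_def)
  moreover have "left_column M' f j \<in> R" if "j < dim_col M'" for j
  proof -
    have "left_column M' f j = vec n (\<lambda>i. f i (M $$ (\<sigma> i, j)))"
      using that by (intro eq_vecI) (auto simp: left_column_def M'_def)
    then show ?thesis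
      using left that by (simp add: M'_def)
  qed
  ultimately have "right_column M' f \<in> R"
    unfolding strictly_closed_def by blast
  then show ?thesis
    by (simp add: right_column_def M'_def)
qed

section \<open>Tuples and maps acting on them coordinatewise\<close>

lemma vec_in_tuples: "(\<And>i. i < n \<Longrightarrow> f i \<in> X) \<Longrightarrow> vec n f \<in> tuples n X"
  by (simp add: tuples_def)

lemma map_vec_vec: "map_vec h (vec n f) = vec n (\<lambda>i. h (f i))"
  by (intro eq_vecI) auto

lemma map_vec_tuples: "v \<in> tuples n X \<Longrightarrow> h \<in> X \<rightarrow> Y \<Longrightarrow> map_vec h v \<in> tuples n Y"
  by (auto simp: tuples_def)

lemma map_vec_cong_tuples:
  "v \<in> tuples n X \<Longrightarrow> (\<And>x. x \<in> X \<Longrightarrow> g x = h x) \<Longrightarrow> map_vec g v = map_vec h v"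
  by (intro eq_vecI) (auto simp: tuples_def)

lemma finite_tuples:
  assumes "finite X"
  shows "finite (tuples n X)"
proof -
  have "v \<in> vec n ` (\<Pi>\<^sub>E i\<in>{..<n}. X)" if "v \<in> tuples n X" for v
    using that by (intro image_eqI[of _ _ "restrict (($) v) {..<n}"]) (auto simp: tuples_def)
  then have "tuples n X \<subseteq> vec n ` (\<Pi>\<^sub>E i\<in>{..<n}. X)"
    by blast
  moreover have "finite (vec n ` (\<Pi>\<^sub>E i\<in>{..<n}. X))"
    using assms by (intro finite_imageI finite_PiE) auto
  ultimately show ?thesis
    by (rule finite_subset)
qed

lemma sharp_tuples: "sharp n X M (tuples n X)"
  by (rule sharpI) (auto intro: vec_in_tuples)

lemma sharp_Inter:
  assumes "\<And>R. R \<in> \<R> \<Longrightarrow> sharp n X M R"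
  shows "sharp n X M (\<Inter>\<R>)"
proof (rule sharpI, rule InterI)
  fix n' m k \<sigma> f R
  assume *: "0 < n'" "0 < k" "M \<in> matr n' m k" "\<And>i. i < n \<Longrightarrow> \<sigma> i < n'"
    "\<And>i a. i < n \<Longrightarrow> a < k \<Longrightarrow> f i a \<in> X"
    "\<And>j. j < m \<Longrightarrow> vec n (\<lambda>i. f i (M $$ (\<sigma> i, j))) \<in> \<Inter>\<R>" and R: "R \<in> \<R>"
  show "vec n (\<lambda>i. f i 0) \<in> R"
    using *(6) R by (intro sharpD[OF assms[OF R] *(3,1,2), of \<sigma> f] *(4,5)) auto
qed

text \<open>Composing with \<open>h\<close> in each row turns row-wise interpretations in
  \<open>X\<close> into ones in \<open>Y\<close>, and the left and right columns follow.\<close>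

lemma sharp_vimage:
  assumes sharp: "sharp n Y M R" and h: "h \<in> X \<rightarrow> Y"
  shows "sharp n X M {v \<in> tuples n X. map_vec h v \<in> R}"
proof (rule sharpI)
  fix n' m k \<sigma> f
  assume *: "0 < n'" "0 < k" "M \<in> matr n' m k" "\<And>i. i < n \<Longrightarrow> \<sigma> i < n'"
    and f: "\<And>i a. i < n \<Longrightarrow> a < k \<Longrightarrow> f i a \<in> X"
    and left: "\<And>j. j < m \<Longrightarrow>
      vec n (\<lambda>i. f i (M $$ (\<sigma> i, j))) \<in> {v \<in> tuples n X. map_vec h v \<in> R}"
  have "vec n (\<lambda>i. h (f i 0)) \<in> R"
    using f h left by (intro sharpD[OF sharp *(3,1,2), of \<sigma> "\<lambda>i a. h (f i a)"] *(4))
      (auto simp: map_vec_vec)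
  then show "vec n (\<lambda>i. f i 0) \<in> {v \<in> tuples n X. map_vec h v \<in> R}"
    using f \<open>0 < k\<close> by (auto simp: map_vec_vec intro: vec_in_tuples)
qed

text \<open>The closure behind \<open>col_closure\<close>, over an arbitrary set and from arbitrary
  tuples, so that it also yields the relations of freely generated structures.\<close>

definition sharp_hull :: "nat \<Rightarrow> nat mat set \<Rightarrow> 'a set \<Rightarrow> 'a vec set \<Rightarrow> 'a vec set" where
  "sharp_hull n S X T = \<Inter>{R. R \<subseteq> tuples n X \<and> T \<subseteq> R \<and> (\<forall>M\<in>S. sharp n X M R)}"

lemma sharp_hull_sharp: "M \<in> S \<Longrightarrow> sharp n X M (sharp_hull n S X T)"
  unfolding sharp_hull_def by (rule sharp_Inter) auto

lemma sharp_hull_upper: "T \<subseteq> sharp_hull n S X T"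
  unfolding sharp_hull_def by blast

lemma sharp_hull_tuples: "T \<subseteq> tuples n X \<Longrightarrow> sharp_hull n S X T \<subseteq> tuples n X"
  unfolding sharp_hull_def using sharp_tuples by blast

lemma sharp_hull_least:
  assumes "R \<subseteq> tuples n X" "T \<subseteq> R" "\<And>M. M \<in> S \<Longrightarrow> sharp n X M R"
  shows "sharp_hull n S X T \<subseteq> R"
  unfolding sharp_hull_def by (rule Inter_lower) (use assms in simp)

lemma col_closure_hull: "col_closure n k S N = sharp_hull n S {..<k} (set (cols N))"
  by (simp add: col_closure_def sharp_hull_def)

text \<open>Universal property of the hull: the preimage of \<open>R\<close> under \<open>h\<close>
  is sharp and contains \<open>T\<close>, hence contains the hull.\<close>

lemma map_vec_sharp_hull:
  assumes v: "v \<in> sharp_hull n S X T" and T: "T \<subseteq> tuples n X" and h: "h \<in> X \<rightarrow> Y"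
    and R: "\<And>M. M \<in> S \<Longrightarrow> sharp n Y M R" and TR: "\<And>w. w \<in> T \<Longrightarrow> map_vec h w \<in> R"
  shows "map_vec h v \<in> R"
proof -
  have "sharp_hull n S X T \<subseteq> {v \<in> tuples n X. map_vec h v \<in> R}"
    using T TR sharp_vimage[OF R h] by (intro sharp_hull_least) auto
  with v have "v \<in> {v \<in> tuples n X. map_vec h v \<in> R}"
    by blast
  then show ?thesis
    by simp
qed


section \<open>Closedness in finitely complete categories\<close>

lemma Hom_Obj:
  "is_category C \<Longrightarrow> f \<in> Hom C X Y \<Longrightarrow> X \<in> Obj C"
  "is_category C \<Longrightarrow> f \<in> Hom C X Y \<Longrightarrow> Y \<in> Obj C"
  by (auto simp: is_category_def Hom_def)

lemma Id_Hom: "is_category C \<Longrightarrow> X \<in> Obj C \<Longrightarrow> Id C X \<in> Hom C X X"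
  by (simp add: is_category_def)

lemma Comp_Hom:
  "is_category C \<Longrightarrow> f \<in> Hom C X Y \<Longrightarrow> g \<in> Hom C Y Z \<Longrightarrow> Comp C g f \<in> Hom C X Z"
  using Hom_Obj[of C f X Y] Hom_Obj[of C g Y Z] by (auto simp: is_category_def)

lemma Comp_Id:
  "is_category C \<Longrightarrow> f \<in> Hom C X Y \<Longrightarrow> Comp C f (Id C X) = f"
  "is_category C \<Longrightarrow> f \<in> Hom C X Y \<Longrightarrow> Comp C (Id C Y) f = f"
  using Hom_Obj[of C f X Y] by (auto simp: is_category_def)

lemma Comp_assoc:
  "is_category C \<Longrightarrow> f \<in> Hom C W X \<Longrightarrow> g \<in> Hom C X Y \<Longrightarrow> h \<in> Hom C Y Z \<Longrightarrow>
    Comp C h (Comp C g f) = Comp C (Comp C h g) f"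
  using Hom_Obj[of C f W X] Hom_Obj[of C h Y Z] by (simp add: is_category_def)

text \<open>The limit of a diagram with objects \<open>D 0, \<dots>, D (N - 1)\<close> whose only non-identity arrows are
  \<open>r i : D 0 \<rightarrow> D (t i)\<close> for \<open>i < n\<close>.  As an arrow of the shape category, the number \<open>a < N\<close> is
  the identity of \<open>a\<close>, and \<open>N + i\<close> is sent to \<open>r i\<close>.\<close>

lemma star_limit:
  fixes N n :: nat
  assumes fc: "finitely_complete C"
    and D: "\<And>e. e < N \<Longrightarrow> D e \<in> Obj C"
    and t: "\<And>i. i < n \<Longrightarrow> 0 < t i \<and> t i < N"
    and r: "\<And>i. i < n \<Longrightarrow> r i \<in> Hom C (D 0) (D (t i))"
  shows "\<exists>L\<in>Obj C. \<exists>p. (\<forall>e<N. p e \<in> Hom C L (D e)) \<and> (\<forall>i<n. Comp C (r i) (p 0) = p (t i)) \<and>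
    (\<forall>X\<in>Obj C. \<forall>q. (\<forall>e<N. q e \<in> Hom C X (D e)) \<and> (\<forall>i<n. Comp C (r i) (q 0) = q (t i)) \<longrightarrow>
      (\<exists>!u. u \<in> Hom C X L \<and> (\<forall>e<N. Comp C (p e) u = q e)))"
proof -
  have cat: "is_category C"
    using fc by (simp add: finitely_complete_def)
  \<comment> \<open>Composition returns \<open>a\<close> if \<open>b\<close> is an identity.
    Otherwise \<open>b\<close> starts at 0, and since each \<open>t i\<close> is positive, only the
    identity of 0 can precede it, so the composite is \<open>b\<close>.\<close>
  define J :: "(nat, nat) category" where
    "J = \<lparr>Obj = {..<N}, Arr = {..<N + n}, Dom = (\<lambda>a. if a < N then a else 0),
       Cod = (\<lambda>a. if a < N then a else t (a - N)), Id = id,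
       Comp = (\<lambda>b a. if b < N then a else b)\<rparr>"
  define Fa where "Fa = (\<lambda>a. if a < N then Id C (D a) else r (a - N))"
  have t': "0 < t (a - N)" "t (a - N) < N" if "a < N + n" "\<not> a < N" for a
    using t[of "a - N"] that by auto
  have N: "0 < N" if "a < N + n" "\<not> a < N" for a
    using t'[OF that] by linarith
  have J: "is_category J"
    unfolding is_category_def Hom_def
  proof (intro conjI ballI)
    fix f assume "f \<in> Arr J"
    then show "Dom J f \<in> Obj J" "Cod J f \<in> Obj J"
      using t'(2)[of f] N[of f] by (auto simp: J_def)
  next
    fix X Y Z f g
    assume "f \<in> {f \<in> Arr J. Dom J f = X \<and> Cod J f = Y}"
      "g \<in> {f \<in> Arr J. Dom J f = Y \<and> Cod J f = Z}"
    then show "Comp J g f \<in> {f \<in> Arr J. Dom J f = X \<and> Cod J f = Z}"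
      using t'(1)[of f] by (cases "f < N"; cases "g < N") (simp_all add: J_def)
  qed (simp_all add: J_def)
  have fun_J: "is_functor J C D Fa"
    unfolding is_functor_def
  proof (intro conjI ballI impI)
    fix a assume a: "a \<in> Arr J"
    show "Fa a \<in> Hom C (D (Dom J a)) (D (Cod J a))"
      using a D r[of "a - N"] by (auto simp: J_def Fa_def intro: Id_Hom[OF cat])
  next
    fix a b assume ab: "a \<in> Arr J" "b \<in> Arr J" "Cod J a = Dom J b"
    show "Fa (Comp J b a) = Comp C (Fa b) (Fa a)"
    proof (cases "b < N")
      case True
      have "Fa a \<in> Hom C (D (Dom J a)) (D (Cod J a))"
        using ab(1) D r[of "a - N"] by (auto simp: J_def Fa_def intro: Id_Hom[OF cat])
      then show ?thesis
        using True ab Comp_Id(2)[OF cat] by (auto simp: J_def Fa_def)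
    next
      case False
      then have b: "b - N < n" "0 < N"
        using ab N[of b] by (auto simp: J_def)
      have "a = 0"
        using ab False t'[of a] by (auto simp: J_def split: if_splits)
      then show ?thesis
        using False b Comp_Id(1)[OF cat r[OF b(1)]] by (simp add: J_def Fa_def)
    qed
  qed (use D in \<open>auto simp: J_def Fa_def\<close>)
  have cone: "is_cone J C D Fa X q \<longleftrightarrow> X \<in> Obj C \<and> (\<forall>e<N. q e \<in> Hom C X (D e)) \<and>
      (\<forall>i<n. Comp C (r i) (q 0) = q (t i))" (is "_ \<longleftrightarrow> ?cone") for X q
  proof
    assume c: "is_cone J C D Fa X q"
    have "Comp C (r i) (q 0) = q (t i)" if "i < n" for i
    proof -
      have "N + i \<in> Arr J"
        using that by (simp add: J_def)
      then have "Comp C (Fa (N + i)) (q (Dom J (N + i))) = q (Cod J (N + i))"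
        using c unfolding is_cone_def by blast
      then show ?thesis
        by (simp add: J_def Fa_def)
    qed
    then show ?cone
      using c by (auto simp: is_cone_def J_def)
  next
    assume c: ?cone
    have "Comp C (Fa a) (q (Dom J a)) = q (Cod J a)" if a: "a \<in> Arr J" for a
    proof (cases "a < N")
      case True
      then show ?thesis
        using c Comp_Id(2)[OF cat] by (auto simp: J_def Fa_def)
    next
      case False
      then show ?thesis
        using a c by (auto simp: J_def Fa_def)
    qed
    then show "is_cone J C D Fa X q"
      using c by (auto simp: is_cone_def J_def)
  qed
  have "finite (Obj J)" "finite (Arr J)"
    by (auto simp: J_def)
  then obtain L p where lim: "is_limit J C D Fa L p"
    using fc J fun_J unfolding finitely_complete_def by blast
  have Obj_J: "e \<in> Obj J \<longleftrightarrow> e < N" for e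
    by (simp add: J_def)
  have L: "is_cone J C D Fa L p"
    using lim by (simp add: is_limit_def)
  have univ: "\<exists>!u. u \<in> Hom C X L \<and> (\<forall>e<N. Comp C (p e) u = q e)"
    if "is_cone J C D Fa X q" for X q
    using lim that unfolding is_limit_def Ball_def Obj_J by blast
  show ?thesis
  proof (intro bexI exI conjI ballI allI impI)
    fix X q
    assume "X \<in> Obj C" "(\<forall>e<N. q e \<in> Hom C X (D e)) \<and> (\<forall>i<n. Comp C (r i) (q 0) = q (t i))"
    then show "\<exists>!u. u \<in> Hom C X L \<and> (\<forall>e<N. Comp C (p e) u = q e)"
      by (intro univ) (simp add: cone)
  qed (use L in \<open>simp_all add: cone\<close>)
qed

text \<open>A relation \<open>R\<close> on \<open>A\<close> is turned into the relation on \<open>A\<^sup>n\<close> to which \<open>(b\<^sub>0, b\<^sub>1, \<dots>)\<close> belongs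
  iff \<open>(\<pi>\<^sub>i b\<^bsub>\<sigma> i\<^esub>)\<^sub>i\<close> belongs to \<open>R\<close>; different interpretations of the rows then become the
  components of a single one.\<close>

lemma closed_relations_sharp:
  assumes fc: "finitely_complete C" and closed: "has_closed_relations C M"
    and M: "M \<in> matr n' m k" "0 < n'" "0 < k"
    and rel: "internal_relation C n A R r" and X: "X \<in> Obj C"
    and \<sigma>: "\<And>i. i < n \<Longrightarrow> \<sigma> i < n'"
    and f: "\<And>i a. i < n \<Longrightarrow> a < k \<Longrightarrow> f i a \<in> Hom C X A"
    and left: "\<And>j. j < m \<Longrightarrow> belongs C R r X (vec n (\<lambda>i. f i (M $$ (\<sigma> i, j))))"
  shows "belongs C R r X (vec n (\<lambda>i. f i 0))"
proof -
  have cat: "is_category C"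
    using fc by (simp add: finitely_complete_def)
  have A: "A \<in> Obj C" and R: "R \<in> Obj C" and dim_r: "dim_vec r = n"
    and r: "\<And>i. i < n \<Longrightarrow> r $ i \<in> Hom C R A"
    and mono: "\<And>Y g h. \<lbrakk>Y \<in> Obj C; g \<in> Hom C Y R; h \<in> Hom C Y R;
        \<And>i. i < n \<Longrightarrow> Comp C (r $ i) g = Comp C (r $ i) h\<rbrakk> \<Longrightarrow> g = h"
    using rel by (auto simp: internal_relation_def)
  have dims: "dim_row M = n'" "dim_col M = m"
    and entry: "\<And>i j. i < n' \<Longrightarrow> j < m \<Longrightarrow> M $$ (i, j) < k"
    using M by (auto simp: matr_def)
  \<comment> \<open>The power of \<open>A\<close> with \<open>n\<close> factors is the limit of a
    star without arrows.\<close>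
  obtain B \<pi> where B: "B \<in> Obj C" and \<pi>: "\<And>i. i < n \<Longrightarrow> \<pi> i \<in> Hom C B A"
    and univ: "\<forall>Y\<in>Obj C. \<forall>q. (\<forall>i<n. q i \<in> Hom C Y A) \<longrightarrow>
      (\<exists>!u. u \<in> Hom C Y B \<and> (\<forall>i<n. Comp C (\<pi> i) u = q i))"
    using star_limit[OF fc, of n "\<lambda>_. A" 0] A by (simp add: Bex_def) blast
  have B_univ: "\<exists>!u. u \<in> Hom C Y B \<and> (\<forall>i<n. Comp C (\<pi> i) u = q i)"
    if "Y \<in> Obj C" "\<And>i. i < n \<Longrightarrow> q i \<in> Hom C Y A" for Y q
    using univ that by simp
  have B_eqI: "g = h" if "g \<in> Hom C Y B" "h \<in> Hom C Y B"
    "\<And>i. i < n \<Longrightarrow> Comp C (\<pi> i) g = Comp C (\<pi> i) h" for Y g h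
    using B_univ[of Y "\<lambda>i. Comp C (\<pi> i) g"] that Hom_Obj(1)[OF cat that(1)]
      Comp_Hom[OF cat that(1) \<pi>] by metis
  \<comment> \<open>Vertex 0 carries \<open>R\<close>; vertex \<open>l * n + i + 1\<close> carries
    the copy of \<open>A\<close> for component \<open>i\<close> of the \<open>l\<close>-th of
    \<open>n'\<close> elements of \<open>B\<close>. The arrow \<open>r $ i\<close> ends at component
    \<open>i\<close> of element \<open>\<sigma> i\<close>.\<close>
  define N where "N = Suc (n' * n)"
  define t where "t i = Suc (\<sigma> i * n + i)" for i
  have index: "Suc (l * n + i) < N" if "l < n'" "i < n" for l i
  proof -
    have "l * n + i < Suc l * n"
      using that by simp
    also have "\<dots> \<le> n' * n"
      using that by (intro mult_right_mono) auto
    finally show ?thesis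
      by (simp add: N_def)
  qed
  have index': "e div n < n'" "e mod n < n" "e = e div n * n + e mod n" if "Suc e < N" for e
  proof -
    have "n \<noteq> 0"
      using that by (cases "n = 0") (auto simp: N_def)
    then show "e div n < n'" "e mod n < n" "e = e div n * n + e mod n"
      using that by (auto simp: N_def less_mult_imp_div_less)
  qed
  define D where "D e = (if e = 0 then R else A)" for e :: nat
  have D: "D e \<in> Obj C" for e
    using A R by (simp add: D_def)
  have t: "0 < t i \<and> t i < N" and rD: "r $ i \<in> Hom C (D 0) (D (t i))" if "i < n" for i
    using that r \<sigma> index by (auto simp: D_def t_def)
  obtain R' p where R': "R' \<in> Obj C" and p: "\<And>e. e < N \<Longrightarrow> p e \<in> Hom C R' (D e)"
    and pt: "\<And>i. i < n \<Longrightarrow> Comp C (r $ i) (p 0) = p (t i)"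
    and univ': "\<forall>Y\<in>Obj C. \<forall>q. (\<forall>e<N. q e \<in> Hom C Y (D e)) \<and>
      (\<forall>i<n. Comp C (r $ i) (q 0) = q (t i)) \<longrightarrow>
      (\<exists>!u. u \<in> Hom C Y R' \<and> (\<forall>e<N. Comp C (p e) u = q e))"
    using star_limit[OF fc, of N D n t "\<lambda>i. r $ i"] D t rD by (simp add: Bex_def) blast
  have R'_univ: "\<exists>!u. u \<in> Hom C Y R' \<and> (\<forall>e<N. Comp C (p e) u = q e)"
    if "Y \<in> Obj C" "\<And>e. e < N \<Longrightarrow> q e \<in> Hom C Y (D e)"
      "\<And>i. i < n \<Longrightarrow> Comp C (r $ i) (q 0) = q (t i)" for Y q
    using univ' that by simp
  have p0: "p 0 \<in> Hom C R' R"
    using p[of 0] by (simp add: D_def N_def)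
  have pS: "p (Suc e) \<in> Hom C R' A" if "Suc e < N" for e
    using p[OF that] by (simp add: D_def)
  have "\<exists>u. u \<in> Hom C R' B \<and> (\<forall>i<n. Comp C (\<pi> i) u = p (Suc (l * n + i)))" if "l < n'" for l
    using B_univ[OF R', of "\<lambda>i. p (Suc (l * n + i))"] pS index[OF that] by blast
  then obtain \<rho> where \<rho>: "\<And>l. l < n' \<Longrightarrow> \<rho> l \<in> Hom C R' B"
    and \<pi>\<rho>: "\<And>l i. l < n' \<Longrightarrow> i < n \<Longrightarrow> Comp C (\<pi> i) (\<rho> l) = p (Suc (l * n + i))"
    by metis
  have \<pi>\<rho>u: "Comp C (\<pi> i) (Comp C (\<rho> l) u) = Comp C (p (Suc (l * n + i))) u"
    if "l < n'" "i < n" "u \<in> Hom C Y R'" for l i u Y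
    using Comp_assoc[OF cat that(3) \<rho>[OF that(1)] \<pi>[OF that(2)]] \<pi>\<rho> that by simp
  have rp: "Comp C (r $ i) (Comp C (p 0) u) = Comp C (p (t i)) u"
    if "i < n" "u \<in> Hom C Y R'" for i u Y
    using Comp_assoc[OF cat that(2) p0 r[OF that(1)]] pt that by simp
  have mono': "g = h" if g: "g \<in> Hom C Y R'" and h: "h \<in> Hom C Y R'"
    and eq: "\<And>l. l < n' \<Longrightarrow> Comp C (\<rho> l) g = Comp C (\<rho> l) h" for Y g h
  proof -
    have Y: "Y \<in> Obj C"
      using Hom_Obj(1)[OF cat g] .
    have S: "Comp C (p (Suc (l * n + i))) g = Comp C (p (Suc (l * n + i))) h"
      if "l < n'" "i < n" for l i
      using \<pi>\<rho>u[OF that g] \<pi>\<rho>u[OF that h] eq[OF that(1)] by simp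
    \<comment> \<open>The leg \<open>p 0\<close> is not among the \<open>\<rho> l\<close>. It is
      recovered from them because \<open>r\<close> is jointly monic and \<open>r $ i\<close> after
      \<open>p 0\<close> is component \<open>i\<close> of
      \<open>\<rho> (\<sigma> i)\<close>.\<close>
    have 0: "Comp C (p 0) g = Comp C (p 0) h"
    proof (rule mono[OF Y])
      show "Comp C (p 0) g \<in> Hom C Y R" "Comp C (p 0) h \<in> Hom C Y R"
        using Comp_Hom[OF cat _ p0] g h by auto
      show "Comp C (r $ i) (Comp C (p 0) g) = Comp C (r $ i) (Comp C (p 0) h)" if "i < n" for i
        using rp[OF that g] rp[OF that h] S[OF \<sigma>[OF that] that] by (simp add: t_def)
    qed
    have pgh: "Comp C (p e) g = Comp C (p e) h" if e: "e < N" for e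
    proof (cases e)
      case (Suc d)
      then show ?thesis
        using S[OF index'(1,2), of d d] index'(3)[of d] e by simp
    qed (simp add: 0)
    have "\<exists>!u. u \<in> Hom C Y R' \<and> (\<forall>e<N. Comp C (p e) u = Comp C (p e) g)"
      using rp g by (intro R'_univ[OF Y]) (auto intro: Comp_Hom[OF cat g p])
    then show ?thesis
      using g h pgh by metis
  qed
  have rel': "internal_relation C n' B R' (vec n' \<rho>)"
    using B R' \<rho> mono' by (auto simp: internal_relation_def)
  have "\<exists>u. u \<in> Hom C X B \<and> (\<forall>i<n. Comp C (\<pi> i) u = f i a)" if "a < k" for a
    using B_univ[OF X, of "\<lambda>i. f i a"] f that by blast
  \<comment> \<open>The \<open>n\<close> row functions become the components of one function into
    morphisms to the power \<open>B\<close>.\<close>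
  then obtain F where F: "\<And>a. a < k \<Longrightarrow> F a \<in> Hom C X B"
    and \<pi>F: "\<And>a i. a < k \<Longrightarrow> i < n \<Longrightarrow> Comp C (\<pi> i) (F a) = f i a"
    by metis
  have "belongs C R' (vec n' \<rho>) X (left_column M (\<lambda>_. F) j)" if j: "j < m" for j
  proof -
    obtain w where w: "w \<in> Hom C X R" "\<And>i. i < n \<Longrightarrow> Comp C (r $ i) w = f i (M $$ (\<sigma> i, j))"
      using left[OF j] by (auto simp: belongs_def dim_r)
    \<comment> \<open>A cone over the star: the witness \<open>w\<close> for column \<open>j\<close>
      at vertex 0, and at the others the components of the \<open>F (M $$ (l, j))\<close>, with
      \<open>l\<close> and \<open>i\<close> decoded from the vertex by \<open>div\<close> and
      \<open>mod\<close>.\<close>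
    define q where
      "q e = (case e of 0 \<Rightarrow> w | Suc e \<Rightarrow> Comp C (\<pi> (e mod n)) (F (M $$ (e div n, j))))" for e
    have q: "q e \<in> Hom C X (D e)" if "e < N" for e
      using that w index' j entry
      by (cases e) (auto simp: q_def D_def intro!: Comp_Hom[OF cat F \<pi>])
    have qS: "q (Suc (l * n + i)) = f i (M $$ (l, j))" if "l < n'" "i < n" for l i
      using that entry j by (simp add: q_def \<pi>F)
    have "Comp C (r $ i) (q 0) = q (t i)" if "i < n" for i
      using that w(2) \<sigma> unfolding t_def by (simp add: qS) (simp add: q_def)
    then obtain u where u: "u \<in> Hom C X R'" "\<And>e. e < N \<Longrightarrow> Comp C (p e) u = q e"
      using R'_univ[OF X q] by metis
    have "Comp C (\<rho> l) u = F (M $$ (l, j))" if l: "l < n'" for l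
    proof (rule B_eqI)
      show "Comp C (\<rho> l) u \<in> Hom C X B" "F (M $$ (l, j)) \<in> Hom C X B"
        using l j entry F Comp_Hom[OF cat u(1) \<rho>] by auto
      show "Comp C (\<pi> i) (Comp C (\<rho> l) u) = Comp C (\<pi> i) (F (M $$ (l, j)))" if "i < n" for i
        using \<pi>\<rho>u[OF l that u(1)] u(2)[OF index[OF l that]] qS[OF l that] \<pi>F that entry l j by simp
    qed
    then show ?thesis
      using u(1) by (auto simp: belongs_def left_column_def dims)
  qed
  moreover have "relation_closed C k M B R' (vec n' \<rho>)"
    using closed M rel' unfolding has_closed_relations_def by blast
  moreover have "row_wise_interpretation (dim_row M) k (\<lambda>_. Hom C X B) (\<lambda>_. F)"
    using F by (auto simp: row_wise_interpretation_def)
  ultimately have "belongs C R' (vec n' \<rho>) X (right_column M (\<lambda>_. F))"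
    using X dims unfolding relation_closed_def by blast
  then obtain u where u: "u \<in> Hom C X R'" "\<And>l. l < n' \<Longrightarrow> Comp C (\<rho> l) u = F 0"
    by (auto simp: belongs_def right_column_def dims)
  \<comment> \<open>The leg \<open>p 0\<close> turns a witness for \<open>R'\<close> into one for
    \<open>R\<close>.\<close>
  have "Comp C (r $ i) (Comp C (p 0) u) = f i 0" if "i < n" for i
    using rp[OF that u(1)] \<pi>\<rho>u[OF \<sigma>[OF that] that u(1)] u(2)[OF \<sigma>[OF that]] \<pi>F that M
    by (simp add: t_def)
  then show ?thesis
    using Comp_Hom[OF cat u(1) p0] by (auto simp: belongs_def dim_r)
qed

section \<open>From the column closure to closed relations\<close>

lemma closed_relations_if_col_closure:
  assumes C: "C \<in> mclex S"
    and N: "\<And>n m k. 0 < n \<Longrightarrow> 0 < k \<Longrightarrow> N \<in> matr n m k \<Longrightarrow> 0\<^sub>v n \<in> col_closure n k S N"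
  shows "has_closed_relations C N"
  unfolding has_closed_relations_def relation_closed_def
proof (intro allI impI ballI)
  fix n m k A R r X f
  assume Nm: "0 < n \<and> 0 < k \<and> N \<in> matr n m k" and rel: "internal_relation C n A R r"
    and X: "X \<in> Obj C"
    and f: "row_wise_interpretation (dim_row N) k (\<lambda>_. Hom C X A) (\<lambda>_. f)"
    and left: "\<forall>j<dim_col N. belongs C R r X (left_column N (\<lambda>_. f) j)"
  have fc: "finitely_complete C"
    using C by (simp add: mclex_def)
  have dims: "dim_row N = n" "dim_col N = m"
    and entry: "\<And>i j. i < n \<Longrightarrow> j < m \<Longrightarrow> N $$ (i, j) < k"
    using Nm by (auto simp: matr_def)
  have f': "f a \<in> Hom C X A" if "a < k" for a
    using f Nm that by (auto simp: row_wise_interpretation_def dims)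
  define Q where "Q = {v \<in> tuples n {..<k}. belongs C R r X (map_vec f v)}"
  have "sharp n {..<k} M Q" if "M \<in> S" for M
  proof (rule sharpI)
    fix n' m' k' \<sigma> g
    assume M: "0 < n'" "0 < k'" "M \<in> matr n' m' k'" "\<And>i. i < n \<Longrightarrow> \<sigma> i < n'"
      and g: "\<And>i a. i < n \<Longrightarrow> a < k' \<Longrightarrow> g i a \<in> {..<k}"
      and gl: "\<And>j. j < m' \<Longrightarrow> vec n (\<lambda>i. g i (M $$ (\<sigma> i, j))) \<in> Q"
    have "has_closed_relations C M"
      using C that by (simp add: mclex_def)
    \<comment> \<open>Functions \<open>g i\<close> into \<open>{..<k}\<close> followed by
      \<open>f\<close> give different functions into \<open>Hom C X A\<close> for different rows, so
      closedness is needed in its row-wise form.\<close>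
    then have "belongs C R r X (vec n (\<lambda>i. f (g i 0)))"
      using g gl f'
      by (intro closed_relations_sharp[OF fc _ M(3,1,2) rel X, of \<sigma> "\<lambda>i a. f (g i a)"] M(4))
        (auto simp: Q_def map_vec_vec)
    then show "vec n (\<lambda>i. g i 0) \<in> Q"
      using g M by (auto simp: Q_def map_vec_vec intro: vec_in_tuples)
  qed
  moreover have "set (cols N) \<subseteq> Q"
  proof -
    have "col N j \<in> Q" if "j < m" for j
    proof -
      have "map_vec f (col N j) = left_column N (\<lambda>_. f) j"
        by (intro eq_vecI) (auto simp: left_column_def that dims)
      then have "belongs C R r X (map_vec f (col N j))"
        using left that dims by simp
      moreover have "col N j \<in> carrier_vec n"
        using col_dim[of N j] dims by simp
      moreover have "\<forall>i<n. col N j $ i < k"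
        using entry that dims by simp
      ultimately show ?thesis
        by (simp add: Q_def tuples_def)
    qed
    then show ?thesis
      by (auto simp: cols_def dims)
  qed
  ultimately have "col_closure n k S N \<subseteq> Q"
    unfolding col_closure_hull by (intro sharp_hull_least) (auto simp: Q_def)
  then have "0\<^sub>v n \<in> Q"
    using N Nm by blast
  moreover have "map_vec f (0\<^sub>v n) = right_column N (\<lambda>_. f)"
    by (intro eq_vecI) (auto simp: right_column_def dims)
  ultimately show "belongs C R r X (right_column N (\<lambda>_. f))"
    by (simp add: Q_def)
qed

section \<open>Consistency of the rows of nontrivial matrices\<close>

text \<open>The value at 0 is forced by the values along a row, in the same way for all rows; for
  \<open>i = i'\<close> this means that 0 occurs in the row. Values in \<open>nat\<close> suffice,
  since the structures used later live on sets of natural numbers.\<close>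

definition rows_consistent :: "nat mat \<Rightarrow> bool" where
  "rows_consistent M \<longleftrightarrow>
     (\<forall>i<dim_row M. \<forall>i'<dim_row M. \<forall>f f' :: nat \<Rightarrow> nat.
        (\<forall>j<dim_col M. f (M $$ (i, j)) = f' (M $$ (i', j))) \<longrightarrow> f 0 = f' 0)"

text \<open>Exactly the pairs of equal morphisms belong to the equality relation on
  \<open>A\<close>. With rows \<open>i\<close> and \<open>i'\<close> chosen for its two coordinates,
  the left columns are such pairs, so the right column is one as well.\<close>

lemma rows_consistent_if_nontrivial:
  fixes C :: "('o, 'a) category"
  assumes fc: "finitely_complete C" and closed: "has_closed_relations C M"
    and M: "M \<in> matr n m k" "0 < n" "0 < k" and "\<not> is_preorder C"
  shows "rows_consistent M"
  unfolding rows_consistent_def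
proof (intro allI impI)
  fix i i' and f f' :: "nat \<Rightarrow> nat"
  assume i: "i < dim_row M" "i' < dim_row M"
    and left: "\<forall>j<dim_col M. f (M $$ (i, j)) = f' (M $$ (i', j))"
  have cat: "is_category C"
    using fc by (simp add: finitely_complete_def)
  have dims: "dim_row M = n" "dim_col M = m"
    using M by (auto simp: matr_def)
  obtain X A g h where X: "X \<in> Obj C" and A: "A \<in> Obj C"
    and gh: "g \<in> Hom C X A" "h \<in> Hom C X A" "g \<noteq> h"
    using assms(6) by (auto simp: is_preorder_def)
  let ?r = "vec 2 (\<lambda>_. Id C A)"
  have id: "Comp C (Id C A) u = u" if "u \<in> Hom C Y A" for u Y
    by (rule Comp_Id(2)[OF cat that])
  have "internal_relation C 2 A A ?r"
    using A Id_Hom[OF cat A] by (auto simp: internal_relation_def id dest!: spec[of _ "0::nat"])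
  moreover define \<sigma> where "\<sigma> l = (if l = 0 then i else i')" for l :: nat
  moreover define F where "F l a = (if (if l = 0 then f else f') a = f 0 then g else h)"
    for l a :: nat
  moreover have "belongs C A ?r X (vec 2 (\<lambda>l. F l (M $$ (\<sigma> l, j))))" if "j < m" for j
  proof -
    have "F 0 (M $$ (i, j)) = F 1 (M $$ (i', j))"
      using left that by (simp add: F_def dims)
    then have "F l (M $$ (\<sigma> l, j)) = F 0 (M $$ (i, j))" if "l < 2" for l
      using that by (cases "l = 0") (auto simp: \<sigma>_def less_2_cases_iff)
    moreover have "F 0 (M $$ (i, j)) \<in> Hom C X A"
      using gh by (simp add: F_def)
    ultimately show ?thesis
      using id unfolding belongs_def by (intro bexI[of _ "F 0 (M $$ (i, j))"]) auto
  qed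
  ultimately have "belongs C A ?r X (vec 2 (\<lambda>l. F l 0))"
    using i gh by (intro closed_relations_sharp[OF fc closed M _ X, of 2 A A ?r \<sigma> F])
      (auto simp: dims)
  then obtain u where u: "u \<in> Hom C X A" "\<And>l. l < 2 \<Longrightarrow> Comp C (Id C A) u = F l 0"
    by (auto simp: belongs_def)
  have "F 0 0 = F 1 0"
    using u(2)[of 0] u(2)[of 1] by simp
  then show "f 0 = f' 0"
    using gh by (simp add: F_def split: if_splits)
qed


section \<open>The dual of a category of finite structures\<close>

text \<open>A pair \<open>(s, R)\<close> stands for the structure with underlying set \<open>{..<s}\<close> and relation \<open>R\<close>.\<close>

definition sharp_structs :: "nat \<Rightarrow> nat mat set \<Rightarrow> (nat \<times> nat vec set) set" where
  "sharp_structs n S = {(s, R). R \<subseteq> tuples n {..<s} \<and> (\<forall>M\<in>S. sharp n {..<s} M R)}"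

text \<open>Extensional functions are used so that maps that agree on the underlying set are equal,
  and only finitely many maps join two structures.\<close>

definition struct_maps ::
    "nat \<times> nat vec set \<Rightarrow> nat \<times> nat vec set \<Rightarrow> (nat \<Rightarrow> nat) set" where
  "struct_maps x y = {h \<in> {..<fst x} \<rightarrow>\<^sub>E {..<fst y}. \<forall>v\<in>snd x. map_vec h v \<in> snd y}"

lemma sharp_hull_struct:
  "T \<subseteq> tuples n {..<s} \<Longrightarrow> (s, sharp_hull n S {..<s} T) \<in> sharp_structs n S"
  by (simp add: sharp_structs_def sharp_hull_tuples sharp_hull_sharp)

text \<open>The hull is the relation freely generated by \<open>T\<close>, so preservation needs to
  be checked on generators only.\<close>

lemma sharp_hull_struct_map:
  assumes T: "T \<subseteq> tuples n {..<s}" and y: "y \<in> sharp_structs n S"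
    and h: "\<And>x. x < s \<Longrightarrow> h x < fst y" and TR: "\<And>w. w \<in> T \<Longrightarrow> map_vec h w \<in> snd y"
  shows "restrict h {..<s} \<in> struct_maps (s, sharp_hull n S {..<s} T) y"
proof -
  have "map_vec (restrict h {..<s}) v \<in> snd y" if v: "v \<in> sharp_hull n S {..<s} T" for v
  proof -
    have "map_vec h v \<in> snd y"
      using y h TR by (intro map_vec_sharp_hull[OF v T, where Y = "{..<fst y}"])
        (auto simp: sharp_structs_def)
    moreover have "map_vec (restrict h {..<s}) v = map_vec h v"
      using v sharp_hull_tuples[OF T] by (intro map_vec_cong_tuples[of v n "{..<s}"]) auto
    ultimately show ?thesis
      by simp
  qed
  then show ?thesis
    using h by (auto simp: struct_maps_def)
qed

lemma struct_maps_compose: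
  assumes g: "g \<in> struct_maps x y" and h: "h \<in> struct_maps y z"
    and x: "snd x \<subseteq> tuples n {..<fst x}"
  shows "compose {..<fst x} h g \<in> struct_maps x z"
proof -
  have "map_vec (compose {..<fst x} h g) v \<in> snd z" if v: "v \<in> snd x" for v
  proof -
    have "map_vec (compose {..<fst x} h g) v = map_vec h (map_vec g v)"
      using v x by (intro eq_vecI) (auto simp: compose_def tuples_def)
    then show ?thesis
      using g h v by (simp add: struct_maps_def)
  qed
  moreover have "compose {..<fst x} h g \<in> {..<fst x} \<rightarrow>\<^sub>E {..<fst z}"
    using g h by (auto simp: struct_maps_def compose_def PiE_def Pi_def)
  ultimately show ?thesis
    by (simp add: struct_maps_def)
qed

text \<open>Structures live on initial segments of the natural numbers, so a quotient has to be
  renumbered: \<open>c\<close> sends an element to the number of its class.\<close>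

lemma finite_equiv_index:
  assumes "finite A" and E: "equiv A E"
  obtains c and t :: nat where "c ` A = {..<t}"
    "\<And>x y. x \<in> A \<Longrightarrow> y \<in> A \<Longrightarrow> c x = c y \<longleftrightarrow> (x, y) \<in> E"
proof -
  have "finite (A // E)"
    using assms by (intro finite_quotient) (auto simp: equiv_type)
  then obtain h where h: "bij_betw h (A // E) {0..<card (A // E)}"
    using ex_bij_betw_finite_nat by blast
  define c where "c x = h (E `` {x})" for x
  have "c ` A = h ` (A // E)"
    by (auto simp: c_def quotient_def image_iff)
  then have "c ` A = {..<card (A // E)}"
    using h by (auto simp: bij_betw_def)
  moreover have "c x = c y \<longleftrightarrow> (x, y) \<in> E" if "x \<in> A" "y \<in> A" for x y
  proof -
    have "c x = c y \<longleftrightarrow> E `` {x} = E `` {y}"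
      using h that unfolding c_def bij_betw_def
      by (intro inj_on_eq_iff[of h "A // E"]) (auto intro: quotientI)
    then show ?thesis
      using eq_equiv_class_iff[OF E that] by simp
  qed
  ultimately show ?thesis
    by (rule that)
qed

section \<open>The dual of the category of sharp structures\<close>

text \<open>The category is described independently of how objects and arrows are coded:
  \<open>st\<close> and \<open>fn\<close> decode them, every structure is the decoding of an object,
  and \<open>fn\<close> is full and faithful and reverses arrows.\<close>

locale struct_dual =
  fixes C :: "('o, 'a) category" and n :: nat and S :: "nat mat set"
    and st :: "'o \<Rightarrow> nat \<times> nat vec set" and fn :: "'a \<Rightarrow> nat \<Rightarrow> nat"
  assumes cat: "is_category C"
    and st: "X \<in> Obj C \<Longrightarrow> st X \<in> sharp_structs n S"
    and st_surj: "x \<in> sharp_structs n S \<Longrightarrow> \<exists>X\<in>Obj C. st X = x"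
    and fn: "f \<in> Hom C X Y \<Longrightarrow> fn f \<in> struct_maps (st Y) (st X)"
    and fn_full: "\<lbrakk>X \<in> Obj C; Y \<in> Obj C; h \<in> struct_maps (st Y) (st X)\<rbrakk> \<Longrightarrow>
      \<exists>f\<in>Hom C X Y. fn f = h"
    and fn_faithful: "\<lbrakk>f \<in> Hom C X Y; g \<in> Hom C X Y; fn f = fn g\<rbrakk> \<Longrightarrow> f = g"
    and fn_Comp: "\<lbrakk>f \<in> Hom C X Y; g \<in> Hom C Y Z; z < fst (st Z)\<rbrakk> \<Longrightarrow>
      fn (Comp C g f) z = fn f (fn g z)"
begin

lemma fn_less: "f \<in> Hom C X Y \<Longrightarrow> y < fst (st Y) \<Longrightarrow> fn f y < fst (st X)"
  using fn[of f X Y] by (auto simp: struct_maps_def)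

lemma fn_rel: "f \<in> Hom C X Y \<Longrightarrow> v \<in> snd (st Y) \<Longrightarrow> map_vec (fn f) v \<in> snd (st X)"
  using fn[of f X Y] by (auto simp: struct_maps_def)

lemma st_tuples: "X \<in> Obj C \<Longrightarrow> snd (st X) \<subseteq> tuples n {..<fst (st X)}"
  using st[of X] by (auto simp: sharp_structs_def)

lemma st_sharp: "X \<in> Obj C \<Longrightarrow> M \<in> S \<Longrightarrow> sharp n {..<fst (st X)} M (snd (st X))"
  using st[of X] by (auto simp: sharp_structs_def)

lemma Hom_eqI:
  assumes f: "f \<in> Hom C X Y" and g: "g \<in> Hom C X Y"
    and eq: "\<And>y. y < fst (st Y) \<Longrightarrow> fn f y = fn g y"
  shows "f = g"
proof (rule fn_faithful[OF f g], rule PiE_ext)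
  show "fn f \<in> {..<fst (st Y)} \<rightarrow>\<^sub>E {..<fst (st X)}" "fn g \<in> {..<fst (st Y)} \<rightarrow>\<^sub>E {..<fst (st X)}"
    using fn[OF f] fn[OF g] by (auto simp: struct_maps_def)
qed (use eq in simp)

lemma Hom_exists:
  assumes X: "X \<in> Obj C" and Y: "Y \<in> Obj C" and h: "\<And>y. y < fst (st Y) \<Longrightarrow> h y < fst (st X)"
    and rel: "\<And>v. v \<in> snd (st Y) \<Longrightarrow> map_vec h v \<in> snd (st X)"
  obtains f where "f \<in> Hom C X Y" "\<And>y. y < fst (st Y) \<Longrightarrow> fn f y = h y"
proof -
  have "map_vec (restrict h {..<fst (st Y)}) v = map_vec h v" if "v \<in> snd (st Y)" for v
    using that st_tuples[OF Y] by (intro map_vec_cong_tuples[of v n "{..<fst (st Y)}"]) auto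
  then have "restrict h {..<fst (st Y)} \<in> struct_maps (st Y) (st X)"
    using h rel by (auto simp: struct_maps_def)
  then obtain f where "f \<in> Hom C X Y" "fn f = restrict h {..<fst (st Y)}"
    using fn_full[OF X Y] by blast
  then show ?thesis
    by (intro that[of f]) auto
qed

text \<open>Elements are separated by maps to the structure on two points with the full relation.\<close>

lemma jointly_monic_surj:
  assumes rel: "internal_relation C n' A R r" and e: "e < fst (st R)"
  shows "\<exists>i<n'. \<exists>x<fst (st A). fn (r $ i) x = e"
proof (rule ccontr)
  assume none: "\<not> ?thesis"
  have R: "R \<in> Obj C" and r: "\<And>i. i < n' \<Longrightarrow> r $ i \<in> Hom C R A"
    and mono: "\<And>Y g h. \<lbrakk>Y \<in> Obj C; g \<in> Hom C Y R; h \<in> Hom C Y R;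
        \<And>i. i < n' \<Longrightarrow> Comp C (r $ i) g = Comp C (r $ i) h\<rbrakk> \<Longrightarrow> g = h"
    using rel by (auto simp: internal_relation_def)
  have "(2, tuples n {..<2}) \<in> sharp_structs n S"
    by (auto simp: sharp_structs_def sharp_tuples)
  then obtain Y where Y: "Y \<in> Obj C" "st Y = (2, tuples n {..<2})"
    using st_surj by blast
  have *: "map_vec h v \<in> tuples n {..<2}" if "v \<in> snd (st R)" "\<And>x. h x < 2" for h :: "nat \<Rightarrow> nat" and v
    using that st_tuples[OF R] by (intro map_vec_tuples[of v n "{..<fst (st R)}"]) auto
  obtain g where g: "g \<in> Hom C Y R" "\<And>x. x < fst (st R) \<Longrightarrow> fn g x = 0"
    by (rule Hom_exists[OF Y(1) R, of "\<lambda>_. 0"]) (use * in \<open>auto simp: Y\<close>)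
  \<comment> \<open>The indicator of \<open>e\<close> differs from the zero map only at
    \<open>e\<close>, a point that no \<open>fn (r $ i)\<close> attains by assumption.\<close>
  obtain h where h: "h \<in> Hom C Y R" "\<And>x. x < fst (st R) \<Longrightarrow> fn h x = (if x = e then 1 else 0)"
    by (rule Hom_exists[OF Y(1) R, of "\<lambda>x. if x = e then 1 else 0"]) (use * in \<open>auto simp: Y\<close>)
  have "Comp C (r $ i) g = Comp C (r $ i) h" if i: "i < n'" for i
  proof (rule Hom_eqI)
    show "Comp C (r $ i) g \<in> Hom C Y A" "Comp C (r $ i) h \<in> Hom C Y A"
      using Comp_Hom[OF cat _ r[OF i]] g h by auto
    fix x assume x: "x < fst (st A)"
    then show "fn (Comp C (r $ i) g) x = fn (Comp C (r $ i) h) x"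
      using none i fn_less[OF r[OF i] x] fn_Comp[OF g(1) r[OF i] x] fn_Comp[OF h(1) r[OF i] x]
      by (auto simp: g h)
  qed
  then have "g = h"
    using mono Y(1) g(1) h(1) by blast
  then show False
    using g(2)[OF e] h(2)[OF e] by simp
qed

lemma has_closed_relations:
  assumes MS: "M \<in> S" and cons: "rows_consistent M"
  shows "has_closed_relations C M"
  unfolding has_closed_relations_def relation_closed_def
proof (intro allI impI ballI)
  fix n' m k A R r X f
  assume M: "0 < n' \<and> 0 < k \<and> M \<in> matr n' m k" and rel: "internal_relation C n' A R r"
    and X: "X \<in> Obj C"
    and f: "row_wise_interpretation (dim_row M) k (\<lambda>_. Hom C X A) (\<lambda>_. f)"
    and left: "\<forall>j<dim_col M. belongs C R r X (left_column M (\<lambda>_. f) j)"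
  have dims: "dim_row M = n'" "dim_col M = m"
    using M by (auto simp: matr_def)
  have f': "f a \<in> Hom C X A" if "a < k" for a
    using f M that by (auto simp: row_wise_interpretation_def dims)
  have R: "R \<in> Obj C" and A: "A \<in> Obj C" and dim_r: "dim_vec r = n'"
    and r: "\<And>i. i < n' \<Longrightarrow> r $ i \<in> Hom C R A"
    using rel by (auto simp: internal_relation_def)
  have "\<exists>u. u \<in> Hom C X R \<and> (\<forall>i<n'. Comp C (r $ i) u = f (M $$ (i, j)))" if "j < m" for j
    using left that by (auto simp: belongs_def left_column_def dims dim_r)
  then obtain u where u: "\<And>j. j < m \<Longrightarrow> u j \<in> Hom C X R"
    and ru: "\<And>i j. i < n' \<Longrightarrow> j < m \<Longrightarrow> Comp C (r $ i) (u j) = f (M $$ (i, j))"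
    by metis
  have ur: "fn (u j) (fn (r $ i) x) = fn (f (M $$ (i, j))) x"
    if "i < n'" "j < m" "x < fst (st A)" for i j x
    using fn_Comp[OF u[OF that(2)] r[OF that(1)] that(3)] ru[OF that(1,2)] by simp
  obtain \<iota> \<xi> where \<iota>\<xi>: "\<And>e. e < fst (st R) \<Longrightarrow> \<iota> e < n' \<and> \<xi> e < fst (st A) \<and> fn (r $ \<iota> e) (\<xi> e) = e"
    using jointly_monic_surj[OF rel] by metis
  \<comment> \<open>The values are forced: the sought map must take \<open>fn (r $ i) x\<close> to
    \<open>fn (f 0) x\<close>. Here one preimage \<open>\<xi> e\<close> of \<open>e\<close> is
    fixed.\<close>
  define w where "w e = fn (f 0) (\<xi> e)" for e
  have ue: "fn (u j) e = fn (f (M $$ (\<iota> e, j))) (\<xi> e)" if "e < fst (st R)" "j < m" for e j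
    using ur[of "\<iota> e" j "\<xi> e"] \<iota>\<xi>[OF that(1)] that by simp
  \<comment> \<open>Independence of the chosen preimage: along the rows \<open>\<iota> e\<close> and
    \<open>i\<close>, both functions take the value \<open>fn (u j) e\<close> in column
    \<open>j\<close>, so consistency makes them agree at 0.\<close>
  have wr: "w (fn (r $ i) x) = fn (f 0) x" if i: "i < n'" and x: "x < fst (st A)" for i x
  proof -
    define e where "e = fn (r $ i) x"
    have e: "e < fst (st R)"
      using fn_less[OF r[OF i] x] by (simp add: e_def)
    have "\<forall>j<m. fn (f (M $$ (\<iota> e, j))) (\<xi> e) = fn (f (M $$ (i, j))) x"
      using ue[OF e] ur[OF i _ x] by (simp add: e_def)
    then have "fn (f 0) (\<xi> e) = fn (f 0) x"
      using cons[unfolded rows_consistent_def dims, rule_format, of "\<iota> e" i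
          "\<lambda>a. fn (f a) (\<xi> e)" "\<lambda>a. fn (f a) x"] \<iota>\<xi>[OF e] i by simp
    then show ?thesis
      by (simp add: w_def e_def)
  qed
  have w_rel: "map_vec w v \<in> snd (st X)" if v: "v \<in> snd (st R)" for v
  proof -
    have vt: "v \<in> carrier_vec n" "\<And>l. l < n \<Longrightarrow> v $ l < fst (st R)"
      using v st_tuples[OF R] by (auto simp: tuples_def)
    \<comment> \<open>Coordinate \<open>l\<close> uses row \<open>\<iota> (v $ l)\<close> of
      \<open>M\<close> and evaluates at \<open>\<xi> (v $ l)\<close>. Both vary with
      \<open>l\<close>, which is exactly what sharpness of \<open>X\<close> allows.\<close>
    have "vec n (\<lambda>l. fn (f 0) (\<xi> (v $ l))) \<in> snd (st X)"
    proof (rule sharpD[OF st_sharp[OF X MS]])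
      show "M \<in> matr n' m k" "0 < n'" "0 < k"
        using M by auto
      show "\<iota> (v $ l) < n'" if "l < n" for l
        using \<iota>\<xi> vt(2)[OF that] by blast
      show "fn (f a) (\<xi> (v $ l)) \<in> {..<fst (st X)}" if "l < n" "a < k" for l a
        using fn_less[OF f'[OF that(2)]] \<iota>\<xi> vt(2)[OF that(1)] by blast
      fix j assume j: "j < m"
      have "vec n (\<lambda>l. fn (f (M $$ (\<iota> (v $ l), j))) (\<xi> (v $ l))) = map_vec (fn (u j)) v"
        using vt ue j by (intro eq_vecI) auto
      then show "vec n (\<lambda>l. fn (f (M $$ (\<iota> (v $ l), j))) (\<xi> (v $ l))) \<in> snd (st X)"
        using fn_rel[OF u[OF j] v] by simp
    qed
    moreover have "map_vec w v = vec n (\<lambda>l. fn (f 0) (\<xi> (v $ l)))"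
      using vt by (intro eq_vecI) (auto simp: w_def)
    ultimately show ?thesis
      by simp
  qed
  have w_less: "w e < fst (st X)" if "e < fst (st R)" for e
    using fn_less[OF f'[of 0]] \<iota>\<xi>[OF that] M by (simp add: w_def)
  obtain g where g: "g \<in> Hom C X R" "\<And>e. e < fst (st R) \<Longrightarrow> fn g e = w e"
    using Hom_exists[OF X R, of w] w_less w_rel by blast
  have "Comp C (r $ i) g = f 0" if i: "i < n'" for i
  proof (rule Hom_eqI)
    show "Comp C (r $ i) g \<in> Hom C X A" "f 0 \<in> Hom C X A"
      using Comp_Hom[OF cat g(1) r[OF i]] f' M by auto
    fix x assume x: "x < fst (st A)"
    show "fn (Comp C (r $ i) g) x = fn (f 0) x"
      using fn_Comp[OF g(1) r[OF i] x] g(2)[OF fn_less[OF r[OF i] x]] wr[OF i x] by simp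
  qed
  then show "belongs C R r X (right_column M (\<lambda>_. f))"
    using g(1) by (auto simp: belongs_def right_column_def dims dim_r)
qed

text \<open>With \<open>A\<close> free on one point, morphisms into \<open>A\<close> are elements.
  With \<open>E\<close> free on \<open>n\<close> points and one related tuple, morphisms from
  \<open>X\<close> to \<open>E\<close> are the related tuples of \<open>X\<close>. So belonging to
  \<open>E\<close> over \<open>X\<close> means lying in \<open>col_closure n k S N\<close>.\<close>

lemma col_closure_if_closed_relations:
  assumes closed: "has_closed_relations C N" and N: "N \<in> matr n m k" "0 < n" "0 < k"
  shows "0\<^sub>v n \<in> col_closure n k S N"
proof -
  have dims: "dim_row N = n" "dim_col N = m"
    and entry: "\<And>i j. i < n \<Longrightarrow> j < m \<Longrightarrow> N $$ (i, j) < k"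
    using N by (auto simp: matr_def)
  let ?g = "vec n (\<lambda>i. i)"
  have g: "{?g} \<subseteq> tuples n {..<n}"
    by (auto simp: tuples_def)
  have cols: "set (cols N) \<subseteq> tuples n {..<k}"
    using entry col_dim[of N] by (auto simp: tuples_def cols_def dims)
  \<comment> \<open>The hull of no tuples rather than the empty relation: an empty matrix in
    \<open>S\<close> forces the full relation.\<close>
  obtain A where A: "A \<in> Obj C" "st A = (1, sharp_hull n S {..<1} {})"
    using st_surj[OF sharp_hull_struct[of "{}" n 1]] by auto
  obtain E where E: "E \<in> Obj C" "st E = (n, sharp_hull n S {..<n} {?g})"
    using st_surj[OF sharp_hull_struct[OF g]] by auto
  obtain X where X: "X \<in> Obj C" "st X = (k, col_closure n k S N)"
    using st_surj[OF sharp_hull_struct[OF cols]] by (auto simp: col_closure_hull)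
  have point: "\<exists>f\<in>Hom C Y A. fn f 0 = y" if "Y \<in> Obj C" "y < fst (st Y)" for Y y
  proof -
    have "restrict (\<lambda>_. y) {..<1} \<in> struct_maps (st A) (st Y)"
      unfolding A(2) using that st by (intro sharp_hull_struct_map) auto
    then show ?thesis
      using fn_full[OF that(1) A(1)] by force
  qed
  have hom_A: "f = g" if "f \<in> Hom C Y A" "g \<in> Hom C Y A" "fn f 0 = fn g 0" for f g Y
    using that by (intro Hom_eqI[of f Y A g]) (auto simp: A)
  obtain r where r: "\<And>i. i < n \<Longrightarrow> r i \<in> Hom C E A \<and> fn (r i) 0 = i"
    using point[OF E(1)] unfolding E(2) by (metis fst_conv)
  obtain f where f: "\<And>a. a < k \<Longrightarrow> f a \<in> Hom C X A \<and> fn (f a) 0 = a"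
    using point[OF X(1)] unfolding X(2) by (metis fst_conv)
  have fn_r: "fn (Comp C (r i) u) 0 = fn u i" if "u \<in> Hom C Y E" "i < n" for u Y i
    using fn_Comp[OF that(1), of "r i" A 0] r[OF that(2)] by (simp add: A)
  \<comment> \<open>The \<open>r i\<close> pick the points of \<open>E\<close>, and a map out of
    \<open>E\<close> is determined by its values there.\<close>
  have rel: "internal_relation C n A E (vec n r)"
    unfolding internal_relation_def
  proof (intro conjI ballI allI impI)
    fix Y g h
    assume gh: "g \<in> Hom C Y E" "h \<in> Hom C Y E"
      and eq: "\<forall>i<n. Comp C (vec n r $ i) g = Comp C (vec n r $ i) h"
    show "g = h"
    proof (rule Hom_eqI[OF gh])
      fix i assume "i < fst (st E)"
      then have "i < n"
        by (simp add: E)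
      then show "fn g i = fn h i"
        using eq fn_r[OF gh(1)] fn_r[OF gh(2)] by (metis index_vec)
    qed
  qed (use A E r in auto)
  have "belongs C E (vec n r) X (left_column N (\<lambda>_. f) j)" if j: "j < m" for j
  proof -
    have "map_vec (\<lambda>i. N $$ (i, j)) ?g = col N j"
      using j by (intro eq_vecI) (auto simp: dims)
    moreover have "col N j \<in> col_closure n k S N"
      unfolding col_closure_hull by (rule subsetD[OF sharp_hull_upper]) (use j dims in \<open>simp add: cols_def\<close>)
    ultimately have "restrict (\<lambda>i. N $$ (i, j)) {..<n} \<in> struct_maps (st E) (st X)"
      unfolding E(2) using st[OF X(1)] g entry j
      by (intro sharp_hull_struct_map) (auto simp: X)
    then obtain u where u: "u \<in> Hom C X E" "fn u = restrict (\<lambda>i. N $$ (i, j)) {..<n}"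
      using fn_full[OF X(1) E(1)] by blast
    have "Comp C (r i) u = f (N $$ (i, j))" if "i < n" for i
      using u r[OF that] f[OF entry[OF that j]] fn_r[OF u(1) that] that
      by (intro hom_A[of _ X]) (auto intro: Comp_Hom[OF cat])
    then show ?thesis
      using u(1) by (auto simp: belongs_def left_column_def dims)
  qed
  moreover have "relation_closed C k N A E (vec n r)"
    using closed N rel unfolding has_closed_relations_def by blast
  moreover have "row_wise_interpretation (dim_row N) k (\<lambda>_. Hom C X A) (\<lambda>_. f)"
    using f by (auto simp: row_wise_interpretation_def)
  ultimately have "belongs C E (vec n r) X (right_column N (\<lambda>_. f))"
    using X(1) dims unfolding relation_closed_def by blast
  then obtain u where u: "u \<in> Hom C X E" "\<And>i. i < n \<Longrightarrow> Comp C (r i) u = f 0"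
    by (auto simp: belongs_def right_column_def dims)
  \<comment> \<open>The witness sends the generic tuple \<open>?g\<close> to the zero tuple, which
    is therefore related in \<open>X\<close>.\<close>
  have "fn u i = 0" if "i < n" for i
    using fn_r[OF u(1) that] u(2)[OF that] f N by simp
  then have "map_vec (fn u) ?g = 0\<^sub>v n"
    by (intro eq_vecI) auto
  moreover have "?g \<in> snd (st E)"
    using sharp_hull_upper[of "{?g}"] by (simp add: E)
  ultimately show ?thesis
    using fn_rel[OF u(1)] by (metis X(2) snd_conv)
qed

text \<open>Limits are colimits of structures. Two elements of the coproduct are identified iff every
  cocone into the set \<open>nat\<close> identifies them; no explicit closure of the generating pairs is needed.\<close>

lemma finitely_complete: "finitely_complete C"
  unfolding finitely_complete_def
proof (intro conjI cat allI impI)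
  fix J :: "(nat, nat) category" and Fo Fa
  assume "is_category J \<and> finite (Obj J) \<and> finite (Arr J) \<and> is_functor J C Fo Fa"
  then have J: "is_category J" "finite (Obj J)"
    and Fo: "\<And>i. i \<in> Obj J \<Longrightarrow> Fo i \<in> Obj C"
    and Fa: "\<And>a. a \<in> Arr J \<Longrightarrow> Fa a \<in> Hom C (Fo (Dom J a)) (Fo (Cod J a))"
    by (auto simp: is_functor_def)
  have J_arr: "Dom J a \<in> Obj J" "Cod J a \<in> Obj J" if "a \<in> Arr J" for a
    using J(1) that by (auto simp: is_category_def)
  define s where "s i = fst (st (Fo i))" for i
  define \<Sigma> where "\<Sigma> = (SIGMA i:Obj J. {..<s i})"
  define cocone where "cocone q \<longleftrightarrow>
    (\<forall>a\<in>Arr J. \<forall>y<s (Cod J a). q (Dom J a, fn (Fa a) y) = q (Cod J a, y))" for q :: "nat \<times> nat \<Rightarrow> nat"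
  define E where "E = {(z, z') \<in> \<Sigma> \<times> \<Sigma>. \<forall>q. cocone q \<longrightarrow> q z = q z'}"
  have "finite \<Sigma>"
    using J(2) by (auto simp: \<Sigma>_def)
  moreover have "equiv \<Sigma> E"
    by (rule equivI) (auto simp: E_def refl_on_def sym_def trans_def)
  ultimately obtain c t where c: "c ` \<Sigma> = {..<t::nat}"
    and c_eq: "\<And>z z'. z \<in> \<Sigma> \<Longrightarrow> z' \<in> \<Sigma> \<Longrightarrow> c z = c z' \<longleftrightarrow> (z, z') \<in> E"
    using finite_equiv_index by metis
  have c_less: "c (i, x) < t" if "i \<in> Obj J" "x < s i" for i x
    using c that by (auto simp: \<Sigma>_def)
  \<comment> \<open>The colimit carries the least sharp relation for which all coprojections are
    structure maps.\<close>
  define T where "T = (\<Union>i\<in>Obj J. map_vec (\<lambda>x. c (i, x)) ` snd (st (Fo i)))"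
  have T: "T \<subseteq> tuples n {..<t}"
  proof -
    have "map_vec (\<lambda>x. c (i, x)) v \<in> tuples n {..<t}" if "i \<in> Obj J" "v \<in> snd (st (Fo i))" for i v
      using st_tuples[OF Fo[OF that(1)]] that c_less[OF that(1)]
      by (intro map_vec_tuples[of v n "{..<s i}"]) (auto simp: s_def)
    then show ?thesis
      by (auto simp: T_def)
  qed
  obtain L where L: "L \<in> Obj C" "st L = (t, sharp_hull n S {..<t} T)"
    using st_surj[OF sharp_hull_struct[OF T]] by auto
  have "\<exists>f. f \<in> Hom C L (Fo i) \<and> (\<forall>x<s i. fn f x = c (i, x))" if i: "i \<in> Obj J" for i
  proof -
    have "map_vec (\<lambda>x. c (i, x)) v \<in> snd (st L)" if "v \<in> snd (st (Fo i))" for v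
      unfolding L snd_conv by (rule subsetD[OF sharp_hull_upper]) (use that i in \<open>auto simp: T_def\<close>)
    moreover have "c (i, x) < fst (st L)" if "x < fst (st (Fo i))" for x
      using c_less[OF i] that by (simp add: L s_def)
    ultimately show ?thesis
      using Hom_exists[OF L(1) Fo[OF i], of "\<lambda>x. c (i, x)"] unfolding s_def by metis
  qed
  then obtain p where p: "\<And>i. i \<in> Obj J \<Longrightarrow> p i \<in> Hom C L (Fo i)"
    and fn_p: "\<And>i x. i \<in> Obj J \<Longrightarrow> x < s i \<Longrightarrow> fn (p i) x = c (i, x)"
    by metis
  have fn_less_s: "fn (Fa a) y < s (Dom J a)" if "a \<in> Arr J" "y < s (Cod J a)" for a y
    using fn_less[OF Fa[OF that(1)]] that by (simp add: s_def)
  have "is_cone J C Fo Fa L p"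
    unfolding is_cone_def
  proof (intro conjI ballI L(1) p)
    fix a assume a: "a \<in> Arr J"
    note [simp] = J_arr[OF a]
    show "Comp C (Fa a) (p (Dom J a)) = p (Cod J a)"
    proof (rule Hom_eqI)
      show "Comp C (Fa a) (p (Dom J a)) \<in> Hom C L (Fo (Cod J a))" "p (Cod J a) \<in> Hom C L (Fo (Cod J a))"
        using Comp_Hom[OF cat p Fa[OF a]] p by auto
      fix y assume "y < fst (st (Fo (Cod J a)))"
      then have y: "y < s (Cod J a)"
        by (simp add: s_def)
      have "((Dom J a, fn (Fa a) y), (Cod J a, y)) \<in> E"
        using a y fn_less_s[OF a y] by (auto simp: E_def \<Sigma>_def cocone_def)
      then have "c (Dom J a, fn (Fa a) y) = c (Cod J a, y)"
        using c_eq by (auto simp: E_def)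
      then show "fn (Comp C (Fa a) (p (Dom J a))) y = fn (p (Cod J a)) y"
        using y fn_Comp[OF p Fa[OF a], of y] fn_less_s[OF a y] fn_p by (simp add: s_def)
    qed
  qed
  moreover have "\<exists>!u. u \<in> Hom C X L \<and> (\<forall>i\<in>Obj J. Comp C (p i) u = q i)"
    if cone: "is_cone J C Fo Fa X q" for X q
  proof -
    have X: "X \<in> Obj C" and q: "\<And>i. i \<in> Obj J \<Longrightarrow> q i \<in> Hom C X (Fo i)"
      and Faq: "\<And>a. a \<in> Arr J \<Longrightarrow> Comp C (Fa a) (q (Dom J a)) = q (Cod J a)"
      using cone by (auto simp: is_cone_def)
    define q' where "q' z = fn (q (fst z)) (snd z)" for z
    have q': "cocone q'"
      unfolding cocone_def
    proof (intro ballI allI impI)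
      fix a y assume a: "a \<in> Arr J" and y: "y < s (Cod J a)"
      show "q' (Dom J a, fn (Fa a) y) = q' (Cod J a, y)"
        using fn_Comp[OF q[OF J_arr(1)[OF a]] Fa[OF a], of y] y Faq[OF a] by (simp add: q'_def s_def)
    qed
    \<comment> \<open>Any representative of a class serves: \<open>q'\<close> is itself one of the
      cocones that define \<open>E\<close>, hence constant on classes.\<close>
    define h where "h w = q' (inv_into \<Sigma> c w)" for w
    have h: "h (c (i, x)) = fn (q i) x" if "i \<in> Obj J" "x < s i" for i x
    proof -
      have z: "(i, x) \<in> \<Sigma>"
        using that by (simp add: \<Sigma>_def)
      then have "inv_into \<Sigma> c (c (i, x)) \<in> \<Sigma>" "c (inv_into \<Sigma> c (c (i, x))) = c (i, x)"
        by (auto intro: inv_into_into f_inv_into_f)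
      then have "q' (inv_into \<Sigma> c (c (i, x))) = q' (i, x)"
        using c_eq[OF _ z] q' by (auto simp: E_def)
      then show ?thesis
        by (simp add: h_def q'_def)
    qed
    have surj: "\<exists>i\<in>Obj J. \<exists>x<s i. w = c (i, x)" if "w < t" for w
    proof -
      have "w \<in> c ` \<Sigma>"
        using that c by simp
      then show ?thesis
        by (auto simp: \<Sigma>_def)
    qed
    have "restrict h {..<t} \<in> struct_maps (st L) (st X)"
      unfolding L(2)
    proof (rule sharp_hull_struct_map[OF T st[OF X]])
      fix w assume "w < t"
      then obtain i x where ix: "i \<in> Obj J" "x < s i" "w = c (i, x)"
        using surj by blast
      then show "h w < fst (st X)"
        using h[OF ix(1,2)] fn_less[OF q[OF ix(1)]] by (simp add: s_def)
    next
      fix w assume "w \<in> T"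
      then obtain i v where i: "i \<in> Obj J" and v: "v \<in> snd (st (Fo i))"
        and w: "w = map_vec (\<lambda>x. c (i, x)) v"
        by (auto simp: T_def)
      have "map_vec (\<lambda>x. h (c (i, x))) v = map_vec (fn (q i)) v"
        using v st_tuples[OF Fo[OF i]] h[OF i]
        by (intro map_vec_cong_tuples[of v n "{..<s i}"]) (auto simp: s_def)
      moreover have "map_vec h w = map_vec (\<lambda>x. h (c (i, x))) v"
        unfolding w by (intro eq_vecI) auto
      ultimately show "map_vec h w \<in> snd (st X)"
        using fn_rel[OF q[OF i] v] by simp
    qed
    then obtain u where u: "u \<in> Hom C X L" "fn u = restrict h {..<t}"
      using fn_full[OF X L(1)] by blast
    have fn_pu: "fn (Comp C (p i) u) x = fn u (c (i, x))"
      if "u \<in> Hom C X L" "i \<in> Obj J" "x < s i" for u i x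
      using fn_Comp[OF that(1) p[OF that(2)], of x] fn_p that by (simp add: s_def)
    show ?thesis
    proof (intro ex1I[of _ u] conjI ballI u(1))
      fix i assume i: "i \<in> Obj J"
      show "Comp C (p i) u = q i"
      proof (rule Hom_eqI[OF Comp_Hom[OF cat u(1) p[OF i]] q[OF i]])
        fix x assume "x < fst (st (Fo i))"
        then have x: "x < s i"
          by (simp add: s_def)
        then show "fn (Comp C (p i) u) x = fn (q i) x"
          using fn_pu[OF u(1) i x] u(2) c_less[OF i x] h[OF i x] by simp
      qed
    next
      fix u' assume u': "u' \<in> Hom C X L \<and> (\<forall>i\<in>Obj J. Comp C (p i) u' = q i)"
      \<comment> \<open>Since \<open>c\<close> maps onto \<open>{..<t}\<close>, a morphism into
        \<open>L\<close> is determined by its composites with the \<open>p i\<close>.\<close>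
      show "u' = u"
      proof (rule Hom_eqI)
        show "u' \<in> Hom C X L" "u \<in> Hom C X L"
          using u u' by auto
        fix w assume "w < fst (st L)"
        then have w: "w < t"
          by (simp add: L)
        then obtain i x where ix: "i \<in> Obj J" "x < s i" "w = c (i, x)"
          using surj by blast
        have "fn u' (c (i, x)) = fn (q i) x"
          using fn_pu[OF _ ix(1,2), of u'] u' ix(1) by simp
        then show "fn u' w = fn u w"
          using u(2) w h[OF ix(1,2)] ix(3) by simp
      qed
    qed
  qed
  ultimately show "\<exists>L p. is_limit J C Fo Fa L p"
    unfolding is_limit_def by blast
qed

end

section \<open>Realization of the dual in arbitrary infinite types\<close>

lemma countable_sharp_structs: "countable (sharp_structs n S)"
proof -
  have "countable (SIGMA s:UNIV. Pow (tuples n {..<s :: nat}))"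
    by (intro countable_SIGMA) (auto intro: countable_finite finite_tuples)
  then show ?thesis
    by (rule countable_subset[rotated]) (auto simp: sharp_structs_def)
qed

lemma finite_struct_maps: "finite (struct_maps x y)"
  by (rule finite_subset[of _ "{..<fst x} \<rightarrow>\<^sub>E {..<fst y}"])
    (auto simp: struct_maps_def intro: finite_PiE)

text \<open>Countable sets embed into the natural numbers, and these into every infinite type; this
  provides codes for the structures and their maps.\<close>

lemma countable_inj_infinite:
  assumes "countable A" and "infinite (UNIV :: 'b set)"
  obtains e :: "'a \<Rightarrow> 'b" where "inj_on e A"
proof -
  obtain d :: "nat \<Rightarrow> 'b" where "inj d"
    using assms(2) infinite_countable_subset by blast
  moreover have "inj_on (to_nat_on A) A"
    using assms(1) by (rule inj_on_to_nat_on)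
  ultimately have "inj_on (d \<circ> to_nat_on A) A"
    by (meson comp_inj_on inj_on_subset subset_UNIV)
  then show ?thesis
    by (rule that)
qed

text \<open>An arrow from \<open>x\<close> to \<open>y\<close> of the dual is coded from the triple \<open>(x, y, h)\<close> with \<open>h\<close> a
  structure map from \<open>y\<close> to \<open>x\<close>.\<close>

lemma struct_dual_exists:
  assumes "infinite (UNIV :: 'o set)" and "infinite (UNIV :: 'a set)"
  shows "\<exists>(C :: ('o, 'a) category) st fn. struct_dual C n S st fn"
proof -
  let ?O = "sharp_structs n S"
  define A where "A = (SIGMA x:?O. SIGMA y:?O. struct_maps y x)"
  have "countable A"
    unfolding A_def
    by (intro countable_SIGMA countable_sharp_structs countable_finite finite_struct_maps)
  then obtain ea :: "_ \<Rightarrow> 'a" where ea: "inj_on ea A"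
    using countable_inj_infinite[OF _ assms(2)] by blast
  obtain eo :: "_ \<Rightarrow> 'o" where eo: "inj_on eo ?O"
    using countable_inj_infinite[OF countable_sharp_structs assms(1)] by blast
  define st where "st = inv_into ?O eo"
  define da where "da = inv_into A ea"
  have st[simp]: "st (eo x) = x" if "x \<in> ?O" for x
    using eo that by (simp add: st_def)
  have da[simp]: "da (ea z) = z" if "z \<in> A" for z
    using ea that by (simp add: da_def)
  have eo_eq: "eo x = eo y \<longleftrightarrow> x = y" if "x \<in> ?O" "y \<in> ?O" for x y
    using eo that by (simp add: inj_on_eq_iff)
  define fn where "fn f = snd (snd (da f))" for f
  \<comment> \<open>Arrows are reversed: \<open>g\<close> after \<open>f\<close> is coded from the
    map \<open>fn f\<close> after \<open>fn g\<close>, defined on the underlying set of the codomain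
    of \<open>g\<close>.\<close>
  define C where "C = \<lparr>Obj = eo ` ?O, Arr = ea ` A, Dom = (\<lambda>f. eo (fst (da f))),
    Cod = (\<lambda>f. eo (fst (snd (da f)))), Id = (\<lambda>X. ea (st X, st X, \<lambda>x\<in>{..<fst (st X)}. x)),
    Comp = (\<lambda>g f. ea (fst (da f), fst (snd (da g)), compose {..<fst (fst (snd (da g)))} (fn f) (fn g)))\<rparr>"
  have Obj: "Obj C = eo ` ?O"
    by (simp add: C_def)
  have Hom: "Hom C (eo x) (eo y) = (\<lambda>h. ea (x, y, h)) ` struct_maps y x" (is "?L = ?R")
    if "x \<in> ?O" "y \<in> ?O" for x y
  proof
    show "?L \<subseteq> ?R"
      using that by (auto simp: Hom_def C_def A_def eo_eq)
    show "?R \<subseteq> ?L"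
      using that by (auto simp: Hom_def C_def A_def)
  qed
  have fn_ea: "fn (ea (x, y, h)) = h" if "x \<in> ?O" "y \<in> ?O" "h \<in> struct_maps y x" for x y h
    using that by (simp add: fn_def A_def)
  have Comp: "Comp C (ea (y, z, h)) (ea (x, y, g)) = ea (x, z, compose {..<fst z} g h)"
    if "x \<in> ?O" "y \<in> ?O" "z \<in> ?O" "g \<in> struct_maps y x" "h \<in> struct_maps z y" for x y z g h
    using that by (simp add: C_def A_def fn_def)
  have compose_maps: "compose {..<fst z} g h \<in> struct_maps z x"
    if "z \<in> ?O" "g \<in> struct_maps y x" "h \<in> struct_maps z y" for x y z g h
    using that by (intro struct_maps_compose[where n = n and y = y]) (auto simp: sharp_structs_def)
  have id_maps: "(\<lambda>a\<in>{..<fst x}. a) \<in> struct_maps x x" if "x \<in> ?O" for x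
  proof -
    have "map_vec (\<lambda>a\<in>{..<fst x}. a) v = v" if "v \<in> snd x" for v
      using that \<open>x \<in> ?O\<close> by (intro eq_vecI) (auto simp: sharp_structs_def tuples_def)
    then show ?thesis
      by (auto simp: struct_maps_def)
  qed
  have Id: "Id C (eo x) = ea (x, x, \<lambda>a\<in>{..<fst x}. a)" if "x \<in> ?O" for x
    using that by (simp add: C_def)
  have maps_PiE: "h \<in> {..<fst x} \<rightarrow>\<^sub>E {..<fst y}" if "h \<in> struct_maps x y" for h x y
    using that by (simp add: struct_maps_def)
  have cat: "is_category C"
    unfolding is_category_def
  proof (intro conjI)
    show "\<forall>f\<in>Arr C. Dom C f \<in> Obj C \<and> Cod C f \<in> Obj C"
      by (auto simp: C_def A_def)
    show "\<forall>X\<in>Obj C. Id C X \<in> Hom C X X"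
      by (auto simp: Obj Hom Id id_maps)
    show "\<forall>X\<in>Obj C. \<forall>Y\<in>Obj C. \<forall>Z\<in>Obj C. \<forall>f\<in>Hom C X Y. \<forall>g\<in>Hom C Y Z. Comp C g f \<in> Hom C X Z"
      by (auto simp: Obj Hom Comp compose_maps)
    show "\<forall>X\<in>Obj C. \<forall>Y\<in>Obj C. \<forall>f\<in>Hom C X Y. Comp C f (Id C X) = f \<and> Comp C (Id C Y) f = f"
    proof -
      have "compose {..<fst y} (\<lambda>a\<in>{..<fst x}. a) h = h \<and> compose {..<fst y} h (\<lambda>a\<in>{..<fst y}. a) = h"
        if "h \<in> struct_maps y x" for x y h
        using maps_PiE[OF that] by (auto simp: compose_def fun_eq_iff PiE_def extensional_def)
      then show ?thesis
        by (auto simp: Obj Hom Id Comp id_maps)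
    qed
    show "\<forall>W\<in>Obj C. \<forall>X\<in>Obj C. \<forall>Y\<in>Obj C. \<forall>Z\<in>Obj C.
        \<forall>f\<in>Hom C W X. \<forall>g\<in>Hom C X Y. \<forall>h\<in>Hom C Y Z. Comp C h (Comp C g f) = Comp C (Comp C h g) f"
    proof -
      have "compose {..<fst z} (compose {..<fst y} f g) h = compose {..<fst z} f (compose {..<fst z} g h)"
        if "h \<in> struct_maps z y" for y z and f g h :: "nat \<Rightarrow> nat"
        using maps_PiE[OF that] by (auto simp: compose_def fun_eq_iff PiE_def Pi_def)
      then show ?thesis
        by (auto simp: Obj Hom Comp compose_maps)
    qed
  qed
  have "struct_dual C n S st fn"
  proof
    show "is_category C"
      by (rule cat)
  next
    fix X Y f assume f: "f \<in> Hom C X Y"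
    have "X \<in> Obj C" "Y \<in> Obj C"
      using Hom_Obj[OF cat f] by auto
    then show "fn f \<in> struct_maps (st Y) (st X)"
      using f by (auto simp: Obj Hom fn_ea)
    fix g assume g: "g \<in> Hom C X Y" "fn f = fn g"
    show "f = g"
      using f g \<open>X \<in> Obj C\<close> \<open>Y \<in> Obj C\<close> by (auto simp: Obj Hom fn_ea)
  next
    fix X Y Z f g z assume fg: "f \<in> Hom C X Y" "g \<in> Hom C Y Z" and z: "z < fst (st Z)"
    have "X \<in> Obj C" "Y \<in> Obj C" "Z \<in> Obj C"
      using Hom_Obj[OF cat] fg by auto
    then obtain x y w where xyw: "x \<in> ?O" "y \<in> ?O" "w \<in> ?O" "X = eo x" "Y = eo y" "Z = eo w"
      by (auto simp: Obj)
    then obtain h h' where "h \<in> struct_maps y x" "h' \<in> struct_maps w y"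
      "f = ea (x, y, h)" "g = ea (y, w, h')"
      using fg by (auto simp: Hom)
    then show "fn (Comp C g f) z = fn f (fn g z)"
      using xyw z by (simp add: Comp fn_ea compose_maps compose_eq)
  next
    fix X Y h assume "X \<in> Obj C" "Y \<in> Obj C" "h \<in> struct_maps (st Y) (st X)"
    then show "\<exists>f\<in>Hom C X Y. fn f = h"
      by (auto simp: Obj Hom fn_ea)
  qed (auto simp: Obj)
  then show ?thesis
    by blast
qed

section \<open>Inclusions between \<open>mclex\<close> collections and column closures\<close>

theorem corollary3p5:
  fixes S U :: "nat mat set"
  assumes "matrix_set S" and "matrix_set U"
  shows
    "((\<forall>n m k. n > 0 \<and> k > 0 \<longrightarrow> (\<forall>N\<in>U \<inter> matr n m k. 0\<^sub>v n \<in> col_closure n k S N)) \<longrightarrow>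
        (mclex S :: ('o, 'a) category set) \<subseteq> mclex U) \<and>
     (infinite (UNIV :: 'p set) \<and> infinite (UNIV :: 'q set) \<and>
      (\<forall>M\<in>S. \<not> trivial_matrix TYPE(('r, 's) category) M) \<and>
      (mclex S :: ('p, 'q) category set) \<subseteq> mclex U \<longrightarrow>
        (\<forall>n m k. n > 0 \<and> k > 0 \<longrightarrow> (\<forall>N\<in>U \<inter> matr n m k. 0\<^sub>v n \<in> col_closure n k S N)))"
proof (intro conjI impI)
  assume *: "\<forall>n m k. n > 0 \<and> k > 0 \<longrightarrow> (\<forall>N\<in>U \<inter> matr n m k. 0\<^sub>v n \<in> col_closure n k S N)"
  show "(mclex S :: ('o, 'a) category set) \<subseteq> mclex U"
  proof
    fix C :: "('o, 'a) category"
    assume C: "C \<in> mclex S"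
    have "has_closed_relations C N" if "N \<in> U" for N
      using * that by (intro closed_relations_if_col_closure[OF C]) blast
    then show "C \<in> mclex U"
      using C by (simp add: mclex_def)
  qed
next
  assume *: "infinite (UNIV :: 'p set) \<and> infinite (UNIV :: 'q set) \<and>
    (\<forall>M\<in>S. \<not> trivial_matrix TYPE(('r, 's) category) M) \<and>
    (mclex S :: ('p, 'q) category set) \<subseteq> mclex U"
  have cons: "rows_consistent M" if MS: "M \<in> S" for M
  proof -
    obtain n m k where M: "0 < n" "0 < k" "M \<in> matr n m k"
      using assms(1) MS by (auto simp: matrix_set_def)
    \<comment> \<open>The witness of nontriviality may have other object and arrow types than the
      dual category; only the combinatorial condition on \<open>M\<close> is carried over.\<close>
    obtain D :: "('r, 's) category" where
      "finitely_complete D" "has_closed_relations D M" "\<not> is_preorder D"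
      using * MS by (auto simp: trivial_matrix_def)
    then show ?thesis
      using M by (intro rows_consistent_if_nontrivial)
  qed
  show "\<forall>n m k. n > 0 \<and> k > 0 \<longrightarrow> (\<forall>N\<in>U \<inter> matr n m k. 0\<^sub>v n \<in> col_closure n k S N)"
  proof (intro allI impI ballI)
    fix n m k N
    assume nk: "0 < n \<and> 0 < k" and N: "N \<in> U \<inter> matr n m k"
    \<comment> \<open>The arity of the structures is the number of rows of \<open>N\<close>, so the
      category depends on \<open>N\<close>.\<close>
    obtain C :: "('p, 'q) category" and st fn where "struct_dual C n S st fn"
      using struct_dual_exists * by blast
    then interpret struct_dual C n S st fn .
    have "C \<in> mclex S"
      using finitely_complete has_closed_relations cons by (simp add: mclex_def)
    then have "has_closed_relations C N"
      using * N by (auto simp: mclex_def)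
    then show "0\<^sub>v n \<in> col_closure n k S N"
      using N nk by (intro col_closure_if_closed_relations) auto
  qed
qed

end
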